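(* Let $d=2$, $\widetilde\Psi\in\mathbb{R}$, and let $A$ be the Aharonov–Bohm vector potential $$A(x,y)=\widetilde\Psi\Big(\frac{-y}{x^2+y^2},\frac{x}{x^2+y^2}\Big),\qquad (x,y)\in\mathbb{R}^2\setminus\{0\}.$$ Then for all $\psi\in C_0^\infty(\mathbb{R}^2\setminus\{0\})$, $$\int_{\mathbb{R}^2}|\Delta_A\psi(x)|^2\,dx\ \ge\ C_{\mathrm{AB}}\int_{\mathbb{R}^2}\frac{|\nabla_A\psi(x)|^2}{|x|^2}\,dx,\qquad C_{\mathrm{AB}}=\min_{m\in\mathbb{Z}}\frac{\big((m+\widetilde\Psi)^2-1\big)^2}{(m+\widetilde\Psi)^2+1}.$$
   Context: $\nabla_A:=\nabla-iA$ is the magnetic gradient and $-\Delta_A:=-\nabla_A^2=-(\nabla-iA)\cdot(\nabla-iA)$ the magnetic Laplacian. Functions $\psi$ are complex-valued. *)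

theory Defs
  imports "HOL-Analysis.Analysis"
begin

definition partial_deriv :: "'n::finite \<Rightarrow> (real^'n \<Rightarrow> complex) \<Rightarrow> real^'n \<Rightarrow> complex" where
  "partial_deriv j f x = frechet_derivative f (at x) (axis j 1)"

text \<open>Intended for open \<open>S\<close>, where \<open>differentiable_on\<close> is (Frechet) differentiability
  at every point of \<open>S\<close> and agrees with the unrestricted derivative in \<open>partial_deriv\<close>.\<close>

primrec Ck_on :: "nat \<Rightarrow> (real^'n::finite \<Rightarrow> complex) \<Rightarrow> (real^'n) set \<Rightarrow> bool" where
  "Ck_on 0 f S \<longleftrightarrow> continuous_on S f"
| "Ck_on (Suc k) f S \<longleftrightarrow> f differentiable_on S \<and> (\<forall>j. Ck_on k (partial_deriv j f) S)"

definition smooth_on :: "(real^'n::finite \<Rightarrow> complex) \<Rightarrow> (real^'n) set \<Rightarrow> bool" where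
  "smooth_on f S \<longleftrightarrow> (\<forall>k. Ck_on k f S)"

text \<open>The space of complex test functions on an open set \<open>S\<close>. Its elements are total functions
  on the whole space; as the closed support lies in \<open>S\<close>, they are the extensions
  by zero of the smooth functions on \<open>S\<close> with compact support in \<open>S\<close>.\<close>

definition test_functions :: "(real^'n::finite) set \<Rightarrow> (real^'n \<Rightarrow> complex) set" where
  "test_functions S =
    {\<psi>. smooth_on \<psi> S \<and> compact (closure {x. \<psi> x \<noteq> 0}) \<and> closure {x. \<psi> x \<noteq> 0} \<subseteq> S}"

definition magnetic_partial ::
  "(real^'n::finite \<Rightarrow> real^'n) \<Rightarrow> 'n \<Rightarrow> (real^'n \<Rightarrow> complex) \<Rightarrow> real^'n \<Rightarrow> complex" where
  "magnetic_partial A j \<psi> x = partial_deriv j \<psi> x - \<i> * complex_of_real (A x $ j) * \<psi> x"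

definition magnetic_gradient ::
  "(real^'n::finite \<Rightarrow> real^'n) \<Rightarrow> (real^'n \<Rightarrow> complex) \<Rightarrow> real^'n \<Rightarrow> complex^'n" where
  "magnetic_gradient A \<psi> x = (\<chi> j. magnetic_partial A j \<psi> x)"

definition magnetic_divergence ::
  "(real^'n::finite \<Rightarrow> real^'n) \<Rightarrow> (real^'n \<Rightarrow> complex^'n) \<Rightarrow> real^'n \<Rightarrow> complex" where
  "magnetic_divergence A F x = (\<Sum>j\<in>UNIV. magnetic_partial A j (\<lambda>y. F y $ j) x)"

definition magnetic_laplacian ::
  "(real^'n::finite \<Rightarrow> real^'n) \<Rightarrow> (real^'n \<Rightarrow> complex) \<Rightarrow> real^'n \<Rightarrow> complex" where
  "magnetic_laplacian A \<psi> = magnetic_divergence A (magnetic_gradient A \<psi>)"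

text \<open>Division by zero makes the value at the origin \<open>0\<close>; test functions vanish near it.\<close>

definition aharonov_bohm :: "real \<Rightarrow> real^2 \<Rightarrow> real^2" where
  "aharonov_bohm \<Psi> x =
    \<Psi> *\<^sub>R vector [- (x $ 2) / ((x $ 1)\<^sup>2 + (x $ 2)\<^sup>2), x $ 1 / ((x $ 1)\<^sup>2 + (x $ 2)\<^sup>2)]"

definition AB_quotient :: "real \<Rightarrow> int \<Rightarrow> real" where
  "AB_quotient \<Psi> m = ((of_int m + \<Psi>)\<^sup>2 - 1)\<^sup>2 / ((of_int m + \<Psi>)\<^sup>2 + 1)"

text \<open>The minimum over an infinite set, so \<open>Min\<close> is not applicable. \<open>LEAST\<close> is unspecified
  when no minimum exists; existence therefore has to be asserted separately.\<close>

definition C_AB :: "real \<Rightarrow> real" where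
  "C_AB \<Psi> = (LEAST c. c \<in> range (AB_quotient \<Psi>))"

end

theory Submission
  imports Defs
begin

text \<open>
  Let \<open>R = x \<cdot> \<nabla>\<close>, \<open>B = R - 1\<close> and \<open>L = x\<^sub>1 \<partial>\<^sub>2 - x\<^sub>2 \<partial>\<^sub>1 - i \<Psi>\<close>. Then
  \<open>|x|\<^sup>2 \<Delta>\<^sub>A = R\<^sup>2 + L\<^sup>2 = B\<^sup>2 + 2 B + (1 + L\<^sup>2)\<close> and \<open>|x|\<^sup>2 |\<nabla>\<^sub>A \<psi>|\<^sup>2 = |R \<psi>|\<^sup>2 + |L \<psi>|\<^sup>2\<close>.
  In the inner product with weight \<open>|x|\<close> to the power \<open>-4\<close> both \<open>B\<close> and \<open>L\<close> are skew-symmetric, and they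
  commute. Expanding the square gives
  \<open>\<parallel>B\<^sup>2 \<psi>\<parallel>\<^sup>2 + 2 \<parallel>B \<psi>\<parallel>\<^sup>2 + 2 \<parallel>L B \<psi>\<parallel>\<^sup>2 + \<parallel>(1 + L\<^sup>2) \<psi>\<parallel>\<^sup>2\<close> for the left-hand side, while the right-hand
  side is \<open>C (\<parallel>B \<psi>\<parallel>\<^sup>2 + \<parallel>\<psi>\<parallel>\<^sup>2 + \<parallel>L \<psi>\<parallel>\<^sup>2)\<close> with \<open>C \<le> 1\<close>. What remains,
  \<open>\<parallel>(1 + L\<^sup>2) \<psi>\<parallel>\<^sup>2 \<ge> C (\<parallel>\<psi>\<parallel>\<^sup>2 + \<parallel>L \<psi>\<parallel>\<^sup>2)\<close>, holds on each circle about the origin, since there \<open>L\<close> is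
  diagonalised by Fourier series with eigenvalues \<open>i (m - \<Psi>)\<close>; averaging over rotations transfers
  it to the plane.
\<close>

subsection \<open>Smooth functions and test functions\<close>

lemma partial_deriv_has_derivative:
  "(f has_derivative f') (at x) \<Longrightarrow> partial_deriv j f x = f' (axis j 1)"
  unfolding partial_deriv_def using frechet_derivative_at by metis

lemma has_derivative_partial_deriv:
  assumes "f differentiable (at (x :: real^'n::finite))"
  shows "(f has_derivative (\<lambda>h. \<Sum>j\<in>UNIV. (h $ j) *\<^sub>R partial_deriv j f x)) (at x)"
proof -
  have D: "(f has_derivative frechet_derivative f (at x)) (at x)"
    using assms frechet_derivative_works by blast
  interpret linear "frechet_derivative f (at x)"
    using assms linear_frechet_derivative by blast
  have "frechet_derivative f (at x) h = (\<Sum>j\<in>UNIV. (h $ j) *\<^sub>R partial_deriv j f x)" for h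
  proof -
    have "frechet_derivative f (at x) h
        = frechet_derivative f (at x) (\<Sum>j\<in>UNIV. (h $ j) *\<^sub>R axis j 1)"
      by (simp add: scalar_mult_eq_scaleR[symmetric] basis_expansion)
    then show ?thesis by (simp add: sum scaleR partial_deriv_def)
  qed
  then have "frechet_derivative f (at x) = (\<lambda>h. \<Sum>j\<in>UNIV. (h $ j) *\<^sub>R partial_deriv j f x)" by auto
  with D show ?thesis by simp
qed

lemma partial_deriv_add:
  assumes "f differentiable (at x)" "g differentiable (at x)"
  shows "partial_deriv j (\<lambda>x. f x + g x) x = partial_deriv j f x + partial_deriv j g x"
  using assms unfolding partial_deriv_def
  by (subst frechet_derivative_at[symmetric, OF has_derivative_add])
     (auto simp: frechet_derivative_works)

lemma partial_deriv_mult: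
  assumes "f differentiable (at x)" "g differentiable (at x)"
  shows "partial_deriv j (\<lambda>x. f x * g x) x = partial_deriv j f x * g x + f x * partial_deriv j g x"
  using assms unfolding partial_deriv_def
  by (subst frechet_derivative_at[symmetric, OF has_derivative_mult])
     (auto simp: frechet_derivative_works)

lemma partial_deriv_const [simp]: "partial_deriv j (\<lambda>x. c) x = 0"
  by (simp add: partial_deriv_has_derivative[OF has_derivative_const])

lemma partial_deriv_cnj:
  assumes "f differentiable (at x)"
  shows "partial_deriv j (\<lambda>x. cnj (f x)) x = cnj (partial_deriv j f x)"
  using assms unfolding partial_deriv_def
  by (subst frechet_derivative_at[symmetric, OF has_derivative_cnj])
     (auto simp: frechet_derivative_works)

lemma differentiable_cnj: "f differentiable F \<Longrightarrow> (\<lambda>x. cnj (f x)) differentiable F"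
  unfolding differentiable_def using has_derivative_cnj by blast

lemma has_derivative_coordinate:
  "((\<lambda>y. complex_of_real (y $ k)) has_derivative (\<lambda>h. complex_of_real (h $ k))) (at (x :: real^'n::finite))"
  by (intro bounded_linear_imp_has_derivative bounded_linear_compose[OF bounded_linear_of_real]
      bounded_linear_vec_nth)

lemma partial_deriv_coordinate:
  "partial_deriv j (\<lambda>x::real^'n::finite. complex_of_real (x $ k)) x = (if j = k then 1 else 0)"
  by (simp add: partial_deriv_has_derivative[OF has_derivative_coordinate] axis_def)

lemma partial_deriv_inverse:
  assumes "f differentiable (at x)" "f x \<noteq> 0"
  shows "partial_deriv j (\<lambda>x. inverse (f x)) x = - (partial_deriv j f x * (inverse (f x) * inverse (f x)))"
proof -
  have "(f has_derivative frechet_derivative f (at x)) (at x)"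
    using assms frechet_derivative_works by blast
  from partial_deriv_has_derivative[OF Deriv.has_derivative_inverse[OF assms(2) this]]
  show ?thesis by (simp add: partial_deriv_def mult_ac)
qed

lemma partial_deriv_cong_open:
  assumes "open S" "x \<in> S" "f differentiable (at x)" "\<And>y. y \<in> S \<Longrightarrow> f y = g y"
  shows "partial_deriv j f x = partial_deriv j g x"
  unfolding partial_deriv_def using frechet_derivative_transform_within_open assms by metis

text \<open>The calculus rules give formulas for partial derivatives only at points of
  \<open>S\<close>. This lets such a formula stand in for the derivative inside
  \<open>Ck_on\<close>: for open \<open>S\<close> the unrestricted derivative at a point of
  \<open>S\<close> depends only on the values in \<open>S\<close>.\<close>

lemma Ck_on_cong:
  assumes "open S" "\<And>x. x \<in> S \<Longrightarrow> f x = g x" "Ck_on k f S"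
  shows "Ck_on k g S"
  using assms(2,3)
proof (induction k arbitrary: f g)
  case 0
  then have "continuous_on S f \<longleftrightarrow> continuous_on S g" by (intro continuous_on_cong) auto
  with 0 show ?case by simp
next
  case (Suc k)
  have "f differentiable (at x)" if "x \<in> S" for x
    using Suc.prems(2) that differentiable_on_eq_differentiable_at[OF assms(1)] by auto
  then have "partial_deriv j f x = partial_deriv j g x" if "x \<in> S" for x j
    by (rule partial_deriv_cong_open[OF assms(1) that]) (use that Suc.prems(1) in blast)+
  then have "Ck_on k (partial_deriv j g) S" for j
    by (rule Suc.IH) (use Suc.prems(2) in auto)
  moreover have "g differentiable_on S"
    unfolding differentiable_on_def
  proof
    fix x assume "x \<in> S"
    then have "f differentiable (at x within S)"
      using Suc.prems(2) by (simp add: differentiable_on_def)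
    then show "g differentiable (at x within S)"
      by (rule differentiable_transform_within[OF _ zero_less_one \<open>x \<in> S\<close>]) (rule Suc.prems(1))
  qed
  ultimately show ?case by simp
qed

lemma Ck_on_differentiable_at:
  assumes "open S" "Ck_on (Suc k) f S" "x \<in> S" shows "f differentiable (at x)"
  using assms by (simp add: differentiable_on_eq_differentiable_at)

text \<open>For the Leibniz rule, which leaves one factor undifferentiated while the order drops by
  one.\<close>

lemma Ck_on_lower: "Ck_on (Suc k) f S \<Longrightarrow> Ck_on k f S"
proof (induction k arbitrary: f)
  case 0
  then show ?case by (simp add: differentiable_imp_continuous_on)
next
  case (Suc k)
  have "f differentiable_on S" "\<And>j. Ck_on (Suc k) (partial_deriv j f) S"
    using Suc.prems Ck_on.simps(2) by blast+
  then show ?case using Suc.IH by (subst Ck_on.simps(2)) blast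
qed

lemma Ck_on_const: "Ck_on k (\<lambda>x. c) (S :: (real^'b::finite) set)"
proof (induction k arbitrary: c)
  case (Suc k)
  have "partial_deriv j (\<lambda>x::real^'b. c) = (\<lambda>x. 0)" for j :: 'b by auto
  then show ?case using Suc by simp
qed simp

lemma Ck_on_coordinate: "Ck_on k (\<lambda>x::real^'n::finite. complex_of_real (x $ i)) S"
proof (cases k)
  case 0
  then show ?thesis by (auto intro!: continuous_intros)
next
  case (Suc l)
  have "(\<lambda>x::real^'n. complex_of_real (x $ i)) differentiable_on S"
    using has_derivative_coordinate by (blast intro: differentiable_at_imp_differentiable_on differentiableI)
  moreover have "partial_deriv j (\<lambda>x::real^'n. complex_of_real (x $ i)) = (\<lambda>x. if j = i then 1 else 0)" for j
    by (auto simp: partial_deriv_coordinate)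
  ultimately show ?thesis using Suc by (simp add: Ck_on_const)
qed

lemma Ck_on_cnj:
  assumes "open S" shows "Ck_on k f S \<Longrightarrow> Ck_on k (\<lambda>x. cnj (f x)) S"
proof (induction k arbitrary: f)
  case 0
  then show ?case by (simp add: continuous_on_cnj)
next
  case (Suc k)
  have d: "f differentiable (at x)" if "x \<in> S" for x
    using Ck_on_differentiable_at[OF assms Suc.prems that] .
  have "Ck_on k (partial_deriv j (\<lambda>x. cnj (f x))) S" for j
  proof (rule Ck_on_cong[OF assms])
    show "Ck_on k (\<lambda>x. cnj (partial_deriv j f x)) S"
      using Suc.prems by (intro Suc.IH) simp
  qed (simp add: partial_deriv_cnj d)
  then show ?case using d by (auto intro!: differentiable_at_imp_differentiable_on differentiable_cnj)
qed

lemma Ck_on_add: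
  assumes "open S" shows "Ck_on k f S \<Longrightarrow> Ck_on k g S \<Longrightarrow> Ck_on k (\<lambda>x. f x + g x) S"
proof (induction k arbitrary: f g)
  case 0
  then show ?case by (simp add: continuous_on_add)
next
  case (Suc k)
  have d: "f differentiable (at x)" "g differentiable (at x)" if "x \<in> S" for x
    using Ck_on_differentiable_at[OF assms _ that] Suc.prems by blast+
  have "Ck_on k (partial_deriv j (\<lambda>x. f x + g x)) S" for j
  proof (rule Ck_on_cong[OF assms])
    show "Ck_on k (\<lambda>x. partial_deriv j f x + partial_deriv j g x) S"
      using Suc.prems by (intro Suc.IH) simp_all
  qed (simp add: partial_deriv_add d)
  then show ?case using d by (auto intro!: differentiable_at_imp_differentiable_on)
qed

lemma Ck_on_mult:
  assumes "open S" shows "Ck_on k f S \<Longrightarrow> Ck_on k g S \<Longrightarrow> Ck_on k (\<lambda>x. f x * g x) S"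
proof (induction k arbitrary: f g)
  case 0
  then show ?case by (simp add: continuous_on_mult)
next
  case (Suc k)
  have d: "f differentiable (at x)" "g differentiable (at x)" if "x \<in> S" for x
    using Ck_on_differentiable_at[OF assms _ that] Suc.prems by blast+
  have "Ck_on k (partial_deriv j (\<lambda>x. f x * g x)) S" for j
  proof (rule Ck_on_cong[OF assms])
    show "Ck_on k (\<lambda>x. partial_deriv j f x * g x + f x * partial_deriv j g x) S"
      using Suc.prems Ck_on_lower[OF Suc.prems(1)] Ck_on_lower[OF Suc.prems(2)]
      by (intro Ck_on_add assms Suc.IH) auto
  qed (simp add: partial_deriv_mult d)
  then show ?case using d by (auto intro!: differentiable_at_imp_differentiable_on)
qed

text \<open>The derivative of \<open>1/f\<close> is \<open>- f' / f^2\<close>, which contains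
  \<open>1/f\<close> again. Hence the induction keeps \<open>f\<close> fixed and uses its hypothesis
  for \<open>1/f\<close> itself, at one order less.\<close>

lemma Ck_on_inverse:
  assumes "open S" "\<And>x. x \<in> S \<Longrightarrow> f x \<noteq> 0"
  shows "Ck_on k f S \<Longrightarrow> Ck_on k (\<lambda>x. inverse (f x)) S"
proof (induction k)
  case 0
  then show ?case using assms by (simp add: continuous_on_inverse)
next
  case (Suc k)
  have d: "f differentiable (at x)" if "x \<in> S" for x
    using Ck_on_differentiable_at[OF assms(1) Suc.prems that] .
  have "Ck_on k (\<lambda>x. inverse (f x)) S"
    using Suc Ck_on_lower by blast
  moreover have "Ck_on k (partial_deriv j f) S" for j
    using Suc.prems by simp
  ultimately have *: "Ck_on k (\<lambda>x. (-1) * (partial_deriv j f x * (inverse (f x) * inverse (f x)))) S" for j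
    by (intro Ck_on_mult assms Ck_on_const)
  have "Ck_on k (partial_deriv j (\<lambda>x. inverse (f x))) S" for j
    by (rule Ck_on_cong[OF assms(1) _ *[of j]]) (simp add: partial_deriv_inverse d assms(2))
  then show ?case using d assms(2) by (auto intro!: differentiable_at_imp_differentiable_on differentiable_inverse)
qed

lemma smooth_on_const: "smooth_on (\<lambda>x. c) S"
  and smooth_on_coordinate: "smooth_on (\<lambda>x::real^'n::finite. complex_of_real (x $ i)) S"
  by (simp_all add: smooth_on_def Ck_on_const Ck_on_coordinate)

lemma smooth_on_partial_deriv: "smooth_on f S \<Longrightarrow> smooth_on (partial_deriv j f) S"
  by (metis smooth_on_def Ck_on.simps(2))

lemma smooth_on_differentiable_at: "smooth_on f S \<Longrightarrow> open S \<Longrightarrow> x \<in> S \<Longrightarrow> f differentiable (at x)"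
  using Ck_on_differentiable_at smooth_on_def by blast

lemma
  assumes "open S"
  shows smooth_on_cnj: "smooth_on f S \<Longrightarrow> smooth_on (\<lambda>x. cnj (f x)) S"
    and smooth_on_add: "smooth_on f S \<Longrightarrow> smooth_on g S \<Longrightarrow> smooth_on (\<lambda>x. f x + g x) S"
    and smooth_on_mult: "smooth_on f S \<Longrightarrow> smooth_on g S \<Longrightarrow> smooth_on (\<lambda>x. f x * g x) S"
    and smooth_on_inverse: "smooth_on f S \<Longrightarrow> (\<And>x. x \<in> S \<Longrightarrow> f x \<noteq> 0) \<Longrightarrow> smooth_on (\<lambda>x. inverse (f x)) S"
  using assms by (simp_all add: smooth_on_def Ck_on_cnj Ck_on_add Ck_on_mult Ck_on_inverse)

lemma test_functionsD:
  assumes "f \<in> test_functions S"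
  shows "smooth_on f S" "compact (closure {x. f x \<noteq> 0})" "closure {x. f x \<noteq> 0} \<subseteq> S"
  using assms by (auto simp: test_functions_def)

lemma test_functions_support:
  assumes "smooth_on f S" "compact K" "K \<subseteq> S" "\<And>x. x \<notin> K \<Longrightarrow> f x = 0"
  shows "f \<in> test_functions S"
proof -
  have *: "closure {x. f x \<noteq> 0} \<subseteq> K"
    using assms(2,4) compact_imp_closed by (intro closure_minimal) auto
  then have "compact (closure {x. f x \<noteq> 0})"
    using assms(2) compact_Int_closed[OF assms(2) closed_closure[of "{x. f x \<noteq> 0}"]]
    by (simp add: inf.absorb2)
  then show ?thesis using assms * unfolding test_functions_def by auto
qed

lemma test_functions_smaller_support:
  assumes "f \<in> test_functions S" "smooth_on g S" "\<And>x. x \<notin> closure {x. f x \<noteq> 0} \<Longrightarrow> g x = 0"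
  shows "g \<in> test_functions S"
  by (rule test_functions_support[OF assms(2) _ _ assms(3)]) (use test_functionsD[OF assms(1)] in auto)

lemma test_functions_outside_support: "x \<in> - closure {x. f x \<noteq> 0} \<Longrightarrow> f x = 0"
  using closure_subset[of "{x. f x \<noteq> 0}"] by blast

lemma test_functions_mult:
  assumes "open S" "f \<in> test_functions S" "smooth_on g S"
  shows "(\<lambda>x. g x * f x) \<in> test_functions S"
proof (rule test_functions_smaller_support[OF assms(2)])
  show "smooth_on (\<lambda>x. g x * f x) S"
    using smooth_on_mult[OF assms(1,3) test_functionsD(1)[OF assms(2)]] .
qed (metis ComplI test_functions_outside_support mult_zero_right)

lemma test_functions_cnj:
  assumes "open S" "f \<in> test_functions S" shows "(\<lambda>x. cnj (f x)) \<in> test_functions S"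
proof (rule test_functions_smaller_support[OF assms(2)])
  show "smooth_on (\<lambda>x. cnj (f x)) S"
    using smooth_on_cnj[OF assms(1) test_functionsD(1)[OF assms(2)]] .
qed (metis ComplI test_functions_outside_support complex_cnj_zero)

lemma test_functions_add:
  assumes "open S" "f \<in> test_functions S" "g \<in> test_functions S"
  shows "(\<lambda>x. f x + g x) \<in> test_functions S"
proof (rule test_functions_support)
  show "smooth_on (\<lambda>x. f x + g x) S"
    using smooth_on_add[OF assms(1) test_functionsD(1)[OF assms(2)] test_functionsD(1)[OF assms(3)]] .
  show "compact (closure {x. f x \<noteq> 0} \<union> closure {x. g x \<noteq> 0})"
    "closure {x. f x \<noteq> 0} \<union> closure {x. g x \<noteq> 0} \<subseteq> S"
    using test_functionsD(2,3)[OF assms(2)] test_functionsD(2,3)[OF assms(3)] by blast+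
qed (metis ComplI UnCI add_0 test_functions_outside_support)

lemma test_functions_partial_deriv:
  assumes "open S" "f \<in> test_functions S" shows "partial_deriv j f \<in> test_functions S"
proof (rule test_functions_smaller_support[OF assms(2)])
  show "smooth_on (partial_deriv j f) S"
    using assms test_functionsD smooth_on_partial_deriv by blast
  fix x assume x: "x \<notin> closure {x. f x \<noteq> 0}"
  have "partial_deriv j (\<lambda>x. 0) x = partial_deriv j f x"
  proof (rule partial_deriv_cong_open[of "- closure {x. f x \<noteq> 0}"])
    fix y assume "y \<in> - closure {x. f x \<noteq> 0}"
    then show "0 = f y" by (rule test_functions_outside_support[symmetric])
  qed (use x in auto)
  then show "partial_deriv j f x = 0" by simp
qed

text \<open>Concerns every point of the space: outside \<open>S\<close> the function vanishes on a
  neighbourhood, the complement of its closed support. Thus integrals and translations over the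
  whole space involve no boundary of \<open>S\<close>.\<close>

lemma test_functions_differentiable:
  assumes "open S" "f \<in> test_functions S" shows "f differentiable (at x)"
proof (cases "x \<in> S")
  case True
  then show ?thesis using assms test_functionsD smooth_on_differentiable_at by blast
next
  case False
  then have x: "x \<in> - closure {x. f x \<noteq> 0}" using assms test_functionsD by blast
  have "((\<lambda>x. 0) has_derivative (\<lambda>x. 0)) (at x)" by simp
  then have "(f has_derivative (\<lambda>x. 0)) (at x)"
    by (rule has_derivative_transform_within_open[OF _ open_Compl[OF closed_closure] x])
      (rule test_functions_outside_support[symmetric])
  then show ?thesis by (rule differentiableI)
qed

lemma test_functions_continuous:
  "open S \<Longrightarrow> f \<in> test_functions S \<Longrightarrow> continuous_on X f"
  by (meson continuous_at_imp_continuous_on differentiable_imp_continuous_within test_functions_differentiable)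

lemma test_functions_bounded_support:
  assumes "f \<in> test_functions S" obtains M where "M > 0" "\<And>x. norm x > M \<Longrightarrow> f x = 0"
proof -
  obtain M where M: "M > 0" "\<And>x. x \<in> closure {x. f x \<noteq> 0} \<Longrightarrow> norm x \<le> M"
    using compact_imp_bounded[OF test_functionsD(2)[OF assms]] bounded_pos by blast
  then show ?thesis using that[of M] test_functions_outside_support[of _ f] by (metis ComplI linorder_not_less)
qed

subsection \<open>Mixed partial derivatives and integrals of functions with bounded support\<close>

lemma has_vector_derivative_line:
  assumes "f differentiable (at (x + s *\<^sub>R axis i 1))"
  shows "((\<lambda>s. f (x + s *\<^sub>R axis i 1)) has_vector_derivative partial_deriv i f (x + s *\<^sub>R axis i 1))
    (at s within U)"
proof -
  have *: "(f has_derivative frechet_derivative f (at (x + s *\<^sub>R axis i 1))) (at (x + s *\<^sub>R axis i 1))"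
    using assms frechet_derivative_works by blast
  have "((\<lambda>s. x + s *\<^sub>R axis i 1) has_derivative (\<lambda>h. h *\<^sub>R axis i 1)) (at s within U)"
    by (auto intro!: derivative_eq_intros)
  from diff_chain_within[OF this has_derivative_at_withinI[OF *]]
  have "((\<lambda>s. f (x + s *\<^sub>R axis i 1)) has_derivative
      (\<lambda>h. frechet_derivative f (at (x + s *\<^sub>R axis i 1)) (h *\<^sub>R axis i 1))) (at s within U)"
    by (simp add: o_def)
  moreover have "linear (frechet_derivative f (at (x + s *\<^sub>R axis i 1)))"
    using assms linear_frechet_derivative by blast
  ultimately show ?thesis
    by (simp add: has_vector_derivative_def partial_deriv_def linear_cmul)
qed

text \<open>By differentiation under the integral sign. The increment of \<open>f\<close> in
  direction \<open>j\<close> is the integral of \<open>partial_deriv j f\<close>; differentiating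
  this identity first in direction \<open>i\<close> and then in the upper limit \<open>t\<close>
  produces the two mixed derivatives.\<close>

lemma partial_deriv_commute:
  assumes f: "f \<in> test_functions S" and S: "open S"
  shows "partial_deriv i (partial_deriv j f) x = partial_deriv j (partial_deriv i f) x"
proof -
  note T = test_functions_partial_deriv[OF S]
  note D = test_functions_differentiable[OF S]
  note C = test_functions_continuous[OF S]
  define p where "p s t = x + t *\<^sub>R axis j 1 + s *\<^sub>R axis i 1" for s t
  have p: "p s t = x + s *\<^sub>R axis i 1 + t *\<^sub>R axis j 1" for s t
    by (simp add: p_def algebra_simps)
  have contp: "continuous_on X (\<lambda>z. g (p (u z) (v z)))"
    if "g \<in> test_functions S" "continuous_on X u" "continuous_on X v" for g u v and X :: "'z::topological_space set"
    unfolding p_def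
    by (rule continuous_on_compose2[OF C[OF that(1), of UNIV]])
      (use that in \<open>auto intro!: continuous_intros\<close>)
  have ds: "((\<lambda>s. g (p s t)) has_vector_derivative partial_deriv i g (p s t)) (at s within U)"
    if "g \<in> test_functions S" for g s t U
    unfolding p_def using has_vector_derivative_line D[OF that] by blast
  have dt: "((\<lambda>t. g (p s t)) has_vector_derivative partial_deriv j g (p s t)) (at t within U)"
    if "g \<in> test_functions S" for g s t U
    unfolding p using has_vector_derivative_line D[OF that] by blast
  have ftc: "integral {0..t} (\<lambda>\<tau>. partial_deriv j f (p s \<tau>)) = f (p s t) - f (p s 0)" if "0 \<le> t" for s t
    using that by (intro integral_unique fundamental_theorem_of_calculus dt f)
  have step: "integral {0..t} (\<lambda>\<tau>. partial_deriv i (partial_deriv j f) (p 0 \<tau>))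
      = partial_deriv i f (p 0 t) - partial_deriv i f (p 0 0)" if t: "0 \<le> t" for t
  proof -
    have "((\<lambda>s. integral (cbox 0 t) (\<lambda>\<tau>. partial_deriv j f (p s \<tau>))) has_vector_derivative
        integral (cbox 0 t) (\<lambda>\<tau>. partial_deriv i (partial_deriv j f) (p 0 \<tau>))) (at 0 within UNIV)"
      by (rule leibniz_rule_vector_derivative)
        (use T[OF f] T[OF T[OF f]] in \<open>auto simp: split_beta intro!: ds contp integrable_continuous_real continuous_intros\<close>)
    then have "((\<lambda>s. f (p s t) - f (p s 0)) has_vector_derivative
        integral {0..t} (\<lambda>\<tau>. partial_deriv i (partial_deriv j f) (p 0 \<tau>))) (at 0)"
      by (simp add: ftc[OF t])
    moreover have "((\<lambda>s. f (p s t) - f (p s 0)) has_vector_derivative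
        partial_deriv i f (p 0 t) - partial_deriv i f (p 0 0)) (at 0)"
      by (intro has_vector_derivative_diff ds f)
    ultimately show ?thesis by (rule vector_derivative_unique_at)
  qed
  \<comment> \<open>Since \<open>step\<close> holds for nonnegative \<open>t\<close>, the
    derivatives in \<open>t\<close> are one-sided, taken within a nondegenerate closed interval,
    where they are still unique.\<close>
  have "((\<lambda>t. integral {0..t} (\<lambda>\<tau>. partial_deriv i (partial_deriv j f) (p 0 \<tau>))) has_vector_derivative
      partial_deriv i (partial_deriv j f) (p 0 0)) (at 0 within {0..1})"
    by (rule integral_has_vector_derivative) (auto intro!: contp T f continuous_intros)
  then have "((\<lambda>t. partial_deriv i f (p 0 t) - partial_deriv i f (p 0 0)) has_vector_derivative
      partial_deriv i (partial_deriv j f) (p 0 0)) (at 0 within cbox 0 1)"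
    unfolding box_real(2) by (rule has_vector_derivative_transform[rotated 2]) (auto simp: step)
  moreover have "((\<lambda>t. partial_deriv i f (p 0 t) - partial_deriv i f (p 0 0)) has_vector_derivative
      partial_deriv j (partial_deriv i f) (p 0 0) - 0) (at 0 within cbox 0 1)"
    by (intro has_vector_derivative_diff dt T f has_vector_derivative_const)
  ultimately have "partial_deriv i (partial_deriv j f) (p 0 0) = partial_deriv j (partial_deriv i f) (p 0 0) - 0"
    by (intro vector_derivative_unique_within_closed_interval[where a=0 and b="1::real"]) auto
  then show ?thesis by (simp add: p)
qed

lemma bounded_support_cbox:
  obtains c where "\<And>x::'a::euclidean_space. norm x \<le> M \<Longrightarrow> x \<in> cbox (-c) c"
  using bounded_subset_cbox_symmetric[OF bounded_cball[of "0::'a" M]] by (auto simp: subset_iff)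

lemma integral_UNIV_bounded_support:
  fixes f :: "'a::euclidean_space \<Rightarrow> 'b::banach"
  assumes "\<And>x. x \<notin> K \<Longrightarrow> f x = 0"
  shows "integral UNIV f = integral K f"
proof -
  have "(\<lambda>x. if x \<in> K then f x else 0) = f" using assms by auto
  then show ?thesis using integral_restrict_UNIV[of K f] by simp
qed

lemma absolutely_integrable_bounded_support:
  fixes f :: "'a::euclidean_space \<Rightarrow> 'b::euclidean_space"
  assumes "continuous_on UNIV f" "\<And>x. norm x > M \<Longrightarrow> f x = 0"
  shows "f absolutely_integrable_on UNIV"
proof -
  obtain c where c: "\<And>x::'a. norm x \<le> M \<Longrightarrow> x \<in> cbox (-c) c" using bounded_support_cbox[of M] by blast
  have "f absolutely_integrable_on cbox (-c) c"
    using assms(1) continuous_on_subset by (intro absolutely_integrable_continuous) blast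
  then have "(\<lambda>x. if x \<in> cbox (-c) c then f x else 0) absolutely_integrable_on UNIV"
    by (simp add: absolutely_integrable_restrict_UNIV)
  moreover have "(\<lambda>x. if x \<in> cbox (-c) c then f x else 0) = f"
    using c assms(2) by (auto simp: fun_eq_iff) (metis not_le)
  ultimately show ?thesis by simp
qed

lemma integrable_lborel_bounded_support:
  fixes f :: "'a::euclidean_space \<Rightarrow> 'b::euclidean_space"
  assumes "continuous_on UNIV f" "\<And>x. norm x > M \<Longrightarrow> f x = 0"
  shows "integrable lborel f"
proof -
  have "f \<in> borel_measurable borel"
    using assms(1) by (rule borel_measurable_continuous_onI)
  moreover have "integrable lebesgue f"
    using absolutely_integrable_bounded_support[OF assms] by (simp add: set_integrable_def)
  ultimately show ?thesis by (simp add: integrable_completion)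
qed

lemma integral_translate_bounded_support:
  fixes f :: "'a::euclidean_space \<Rightarrow> 'b::euclidean_space"
  assumes f: "continuous_on UNIV f" "\<And>x. norm x > M \<Longrightarrow> f x = 0"
  shows "integral UNIV (\<lambda>x. f (c + x)) = integral UNIV f"
proof -
  have m: "f \<in> borel_measurable borel"
    using assms(1) by (rule borel_measurable_continuous_onI)
  have "continuous_on UNIV (\<lambda>x. f (c + x))"
    by (rule continuous_on_compose2[OF f(1)]) (auto intro!: continuous_intros)
  moreover have "f (c + x) = 0" if "norm x > M + norm c" for x
    using that norm_triangle_ineq4[of "c + x" c] by (intro f(2)) simp
  ultimately have "integrable lborel (\<lambda>x. f (c + x))" by (rule integrable_lborel_bounded_support)
  then have "integral UNIV (\<lambda>x. f (c + x)) = (\<integral>x. f (c + x) \<partial>lborel)"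
    by (rule integral_lborel)
  also have "\<dots> = (\<integral>x. f x \<partial>distr lborel borel ((+) c))"
    using m by (subst integral_distr) auto
  also have "\<dots> = integral UNIV f"
    using integrable_lborel_bounded_support[OF f] by (simp add: lborel_distr_plus integral_lborel)
  finally show ?thesis .
qed

text \<open>Fubini for a continuous kernel on a box that contains the supports of all
  \<open>K s\<close>.\<close>

lemma integral_swap_bounded_support:
  fixes K :: "real \<Rightarrow> 'a::euclidean_space \<Rightarrow> 'b::euclidean_space"
  assumes K: "continuous_on UNIV (\<lambda>(s, x). K s x)" "\<And>s x. s \<in> {a..b} \<Longrightarrow> norm x > M \<Longrightarrow> K s x = 0"
  shows "integral UNIV (\<lambda>x. integral {a..b} (\<lambda>s. K s x)) = integral {a..b} (\<lambda>s. integral UNIV (K s))"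
proof -
  obtain c where c: "\<And>x::'a. norm x \<le> M \<Longrightarrow> x \<in> cbox (-c) c" using bounded_support_cbox[of M] by blast
  have "integral UNIV (\<lambda>x. integral {a..b} (\<lambda>s. K s x)) = integral (cbox (-c) c) (\<lambda>x. integral {a..b} (\<lambda>s. K s x))"
  proof (rule integral_UNIV_bounded_support)
    fix x assume "x \<notin> cbox (-c) c"
    then have "norm x > M" using c not_le by blast
    then have "integral {a..b} (\<lambda>s. K s x) = integral {a..b} (\<lambda>s. 0)"
      using K(2) by (intro integral_cong) blast
    then show "integral {a..b} (\<lambda>s. K s x) = 0" by simp
  qed
  also have "\<dots> = integral (cbox a b) (\<lambda>s. integral (cbox (-c) c) (K s))"
    using continuous_on_subset[OF K(1)] by (subst integral_swap_continuous) auto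
  also have "\<dots> = integral {a..b} (\<lambda>s. integral UNIV (K s))"
    unfolding box_real(2)
  proof (intro integral_cong integral_UNIV_bounded_support[symmetric])
    fix s x assume s: "s \<in> {a..b}" and "x \<notin> cbox (-c) c"
    then have "norm x > M" using c not_le by blast
    then show "K s x = 0" using K(2) s by blast
  qed
  finally show ?thesis .
qed

text \<open>By averaging over translations: the integral of \<open>partial_deriv j f\<close> equals
  that of each translate by \<open>s e\<close>, hence its mean over \<open>s\<close> in
  \<open>[0,1]\<close>. Swapping the integrals and using the fundamental theorem turns this into the
  integral of \<open>f (e + x) - f x\<close>, which is \<open>0\<close> by translation
  invariance.\<close>

lemma integral_partial_deriv:
  assumes f: "f \<in> test_functions S" and S: "open S"
  shows "integral UNIV (partial_deriv j f) = 0"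
proof -
  note f' = test_functions_partial_deriv[OF S f, of j]
  note C = test_functions_continuous[OF S, of _ UNIV]
  define e :: "real^'a" where "e = axis j 1"
  have e: "norm e = 1" by (simp add: e_def)
  obtain M where M: "M > 0" "\<And>x. norm x > M \<Longrightarrow> partial_deriv j f x = 0"
    using test_functions_bounded_support[OF f'] by blast
  obtain N where N: "N > 0" "\<And>x. norm x > N \<Longrightarrow> f x = 0"
    using test_functions_bounded_support[OF f] by blast
  have ftc: "integral {0..1} (\<lambda>s. partial_deriv j f (s *\<^sub>R e + x)) = f (e + x) - f x" for x
  proof -
    have "((\<lambda>s. partial_deriv j f (x + s *\<^sub>R axis j 1)) has_integral f (x + 1 *\<^sub>R axis j 1) - f (x + 0 *\<^sub>R axis j 1)) {0..1}"
      by (rule fundamental_theorem_of_calculus)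
        (auto intro: has_vector_derivative_line test_functions_differentiable[OF S f])
    then show ?thesis by (simp add: e_def add.commute integral_unique)
  qed
  have "integral UNIV (partial_deriv j f) = integral {0..1::real} (\<lambda>s. integral UNIV (partial_deriv j f))"
    by simp
  also have "\<dots> = integral {0..1} (\<lambda>s. integral UNIV (\<lambda>x. partial_deriv j f (s *\<^sub>R e + x)))"
    by (simp add: integral_translate_bounded_support[OF C[OF f'] M(2)])
  also have "\<dots> = integral UNIV (\<lambda>x. integral {0..1} (\<lambda>s. partial_deriv j f (s *\<^sub>R e + x)))"
  proof (rule integral_swap_bounded_support[symmetric, where M = "M + 1"])
    show "continuous_on UNIV (\<lambda>(s, x). partial_deriv j f (s *\<^sub>R e + x))"
      unfolding split_beta
      by (rule continuous_on_compose2[OF C[OF f']]) (auto intro!: continuous_intros)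
    fix s :: real and x :: "real^'a" assume "s \<in> {0..1}" "norm x > M + 1"
    then show "partial_deriv j f (s *\<^sub>R e + x) = 0"
      using norm_triangle_ineq4[of "s *\<^sub>R e + x" "s *\<^sub>R e"] e by (intro M(2)) simp
  qed
  also have "\<dots> = integral UNIV (\<lambda>x. f (e + x) - f x)"
    by (simp add: ftc)
  also have "\<dots> = integral UNIV (\<lambda>x. f (e + x)) - integral UNIV f"
  proof (rule integral_diff)
    have "continuous_on UNIV (\<lambda>x. f (e + x))"
      by (rule continuous_on_compose2[OF C[OF f]]) (auto intro!: continuous_intros)
    moreover have "f (e + x) = 0" if "norm x > N + 1" for x
      using that norm_triangle_ineq4[of "e + x" e] e by (intro N(2)) simp
    ultimately show "(\<lambda>x. f (e + x)) integrable_on UNIV"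
      using absolutely_integrable_bounded_support set_lebesgue_integral_eq_integral(1) by blast
    show "f integrable_on UNIV"
      using absolutely_integrable_bounded_support[OF C[OF f] N(2)] set_lebesgue_integral_eq_integral(1) by blast
  qed
  also have "\<dots> = 0"
    by (simp add: integral_translate_bounded_support[OF C[OF f] N(2)])
  finally show ?thesis .
qed

section \<open>Rotations of the plane\<close>

text \<open>Complex multiplication by \<open>z\<close>. With a complex parameter instead of an
  angle, \<open>\<lambda>z. f (rotate2 z x)\<close> is a function on the unit circle, so it is
  periodic in the angle and open to polynomial approximation.\<close>

definition rotate2 :: "complex \<Rightarrow> real^2 \<Rightarrow> real^2" where
  "rotate2 z x = vector [Re z * x $ 1 - Im z * x $ 2, Im z * x $ 1 + Re z * x $ 2]"

lemma rotate2_nth [simp]: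
  "rotate2 z x $ 1 = Re z * x $ 1 - Im z * x $ 2" "rotate2 z x $ 2 = Im z * x $ 1 + Re z * x $ 2"
  by (simp_all add: rotate2_def)

lemma power2_norm_vec2: "(norm (x :: real^2))\<^sup>2 = (x $ 1)\<^sup>2 + (x $ 2)\<^sup>2"
  unfolding power2_norm_eq_inner inner_vec_def sum_2 by (simp add: power2_eq_square)

lemma norm_rotate2: "norm (rotate2 z x) = cmod z * norm x"
proof (rule power2_eq_imp_eq)
  show "(norm (rotate2 z x))\<^sup>2 = (cmod z * norm x)\<^sup>2"
    unfolding power_mult_distrib power2_norm_vec2 cmod_power2 rotate2_nth
    by (simp add: algebra_simps power2_eq_square)
qed auto

lemma rotate2_rotate2: "rotate2 z (rotate2 z' x) = rotate2 (z * z') x"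
  by (auto simp: vec_eq_iff forall_2 algebra_simps)

lemma rotate2_one [simp]: "rotate2 1 x = x"
  by (auto simp: vec_eq_iff forall_2)

lemma continuous_on_rotate2:
  assumes "continuous_on X u" "continuous_on X v"
  shows "continuous_on X (\<lambda>z. rotate2 (u z) (v z))"
proof -
  have "rotate2 z x = (Re z * x $ 1 - Im z * x $ 2) *\<^sub>R axis 1 1 + (Im z * x $ 1 + Re z * x $ 2) *\<^sub>R axis 2 1"
    for z x by (simp add: vec_eq_iff forall_2 axis_def)
  then show ?thesis using assms by (auto intro!: continuous_intros)
qed

lemma integral_rotate2:
  fixes f :: "real^2 \<Rightarrow> real"
  assumes f: "continuous_on UNIV f" "\<And>x. norm x > M \<Longrightarrow> f x = 0" and z: "cmod z = 1"
  shows "integral UNIV (\<lambda>x. f (rotate2 z x)) = integral UNIV f"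
proof -
  \<comment> \<open>The linear change of variables is stated for vector-valued functions, so
    \<open>f\<close> is wrapped as a vector of length one and unwrapped through component
    \<open>1\<close>.\<close>
  let ?v = "\<lambda>x. vec (f x) :: real^1"
  have lin: "linear (rotate2 z)"
    by (intro linearI) (auto simp: vec_eq_iff forall_2 algebra_simps)
  have "z * cnj z = 1" using z by (simp add: complex_mult_cnj cmod_power2[symmetric] complex_eq_iff)
  then have "rotate2 z (rotate2 (cnj z) x) = x" for x
    by (simp add: rotate2_rotate2)
  then have surj: "range (rotate2 z) = UNIV" by (metis surjI)
  have det: "det (matrix (rotate2 z)) = 1"
    using z by (simp add: det_2 matrix_def axis_def power2_eq_square[symmetric] cmod_power2[symmetric])
  have cont: "continuous_on UNIV ?v"
    using f(1) by (auto simp: vec_def intro!: continuous_intros)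
  have supp: "?v x = 0" if "norm x > M" for x
    using f(2)[OF that] by (simp add: vec_eq_iff)
  have ai: "?v absolutely_integrable_on UNIV"
    by (rule absolutely_integrable_bounded_support[OF cont supp])
  have "integral UNIV ?v = integral UNIV (?v \<circ> rotate2 z)"
    using integral_change_of_variables_linear[OF lin, where f = ?v and S = UNIV] ai by (simp add: surj det)
  moreover have "integral UNIV ?v $ 1 = integral UNIV f"
    using integral_linear[OF set_lebesgue_integral_eq_integral(1)[OF ai] bounded_linear_vec_nth[of 1]]
    by (simp add: o_def)
  moreover have ai': "(?v \<circ> rotate2 z) absolutely_integrable_on UNIV"
  proof (rule absolutely_integrable_bounded_support)
    show "continuous_on UNIV (?v \<circ> rotate2 z)"
      unfolding o_def by (rule continuous_on_compose2[OF cont]) (auto intro!: continuous_on_rotate2 continuous_intros)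
    show "(?v \<circ> rotate2 z) x = 0" if "norm x > M" for x
      using supp[of "rotate2 z x"] that by (simp add: norm_rotate2 z)
  qed
  moreover have "integral UNIV (?v \<circ> rotate2 z) $ 1 = integral UNIV (\<lambda>x. f (rotate2 z x))"
    using integral_linear[OF set_lebesgue_integral_eq_integral(1)[OF ai'] bounded_linear_vec_nth[of 1]]
    by (simp add: o_def)
  ultimately show ?thesis by simp
qed

subsection \<open>Fourier series on the circle\<close>

text \<open>The factor \<open>1 / (2 pi)\<close> makes \<open>c\<close> the coefficient of
  \<open>c * cis (m t)\<close>; Parseval's identity then carries the factor
  \<open>2 pi\<close>.\<close>

definition fourier_coeff :: "(real \<Rightarrow> complex) \<Rightarrow> int \<Rightarrow> complex" where
  "fourier_coeff v m = integral {0..2*pi} (\<lambda>t. v t * cis (- (of_int m * t))) / (2 * pi)"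

lemma has_vector_derivative_cis:
  "((\<lambda>t. cis (a * t)) has_vector_derivative \<i> * of_real a * cis (a * t)) (at t within S)"
  unfolding has_vector_derivative_def
  by (rule has_derivative_eq_rhs, rule has_derivative_cis)
    (auto intro!: derivative_eq_intros simp: scaleR_conv_of_real)

lemma cis_of_int_2pi: "cis (of_int m * (2 * pi)) = 1"
  using cis_multiple_2pi[of "of_int m"] by (simp add: mult.commute)

lemma integral_cis:
  "integral {0..2*pi} (\<lambda>t. cis (of_int m * t)) = (if m = 0 then 2 * pi else 0)"
proof (cases "m = 0")
  case False
  have "((\<lambda>t. \<i> * of_real (of_int m) * cis (of_int m * t)) has_integral
      cis (of_int m * (2 * pi)) - cis (of_int m * 0)) {0..2*pi}"
    by (intro fundamental_theorem_of_calculus has_vector_derivative_cis) simp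
  from integral_unique[OF this]
  have "(\<i> * of_real (of_int m)) * integral {0..2*pi} (\<lambda>t. cis (of_int m * t)) = 0"
    by (simp only: integral_mult_right cis_of_int_2pi mult_zero_right cis_zero) simp
  then show ?thesis using False by simp
qed (simp add: scaleR_conv_of_real)

lemma fourier_coeff_diff:
  assumes "continuous_on {0..2*pi} v" "continuous_on {0..2*pi} u"
  shows "fourier_coeff (\<lambda>t. v t - u t) m = fourier_coeff v m - fourier_coeff u m"
  unfolding fourier_coeff_def left_diff_distrib
  using assms by (subst integral_diff)
    (auto simp: diff_divide_distrib intro!: integrable_continuous_real continuous_intros)

lemma fourier_coeff_cmult: "fourier_coeff (\<lambda>t. c * v t) m = c * fourier_coeff v m"
  by (simp add: fourier_coeff_def mult.assoc)

lemma fourier_coeff_cis: "fourier_coeff (\<lambda>t. cis (of_int k * t)) m = (if k = m then 1 else 0)"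
proof -
  have "cis (of_int k * t) * cis (- (of_int m * t)) = cis (of_int (k - m) * t)" for t
    by (simp add: cis_mult algebra_simps)
  then show ?thesis by (simp only: fourier_coeff_def integral_cis) simp
qed

lemma norm_diff_power2: "(cmod (a - b))\<^sup>2 = (cmod a)\<^sup>2 - 2 * Re (a * cnj b) + (cmod b)\<^sup>2"
  by (simp only: cmod_power2) (simp add: power2_eq_square algebra_simps)

text \<open>Expanding the square, the cross term is \<open>2 pi\<close> times a product of
  \<open>cnj c\<close> and the Fourier coefficient; completing the square in \<open>c\<close> gives
  the right-hand side.\<close>

lemma integral_norm_diff_trig_monomial:
  assumes v: "continuous_on {0..2*pi} v"
  shows "integral {0..2*pi} (\<lambda>t. (cmod (v t - c * cis (of_int m * t)))\<^sup>2)
    = integral {0..2*pi} (\<lambda>t. (cmod (v t))\<^sup>2)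
      + 2 * pi * ((cmod (c - fourier_coeff v m))\<^sup>2 - (cmod (fourier_coeff v m))\<^sup>2)"
proof -
  define g where "g t = cnj c * (v t * cis (- (of_int m * t)))" for t
  have "(cmod (v t - c * cis (of_int m * t)))\<^sup>2
      = (cmod (v t))\<^sup>2 - 2 * Re (g t) + (cmod c)\<^sup>2" for t
    unfolding norm_diff_power2 g_def by (simp add: norm_mult cis_cnj mult_ac)
  moreover have g: "g integrable_on {0..2*pi}"
    unfolding g_def using v by (intro integrable_continuous_real continuous_intros)
  moreover have int_g: "integral {0..2*pi} (\<lambda>t. Re (g t)) = Re (integral {0..2*pi} g)"
    using integral_linear[OF g bounded_linear_Re] by (simp add: o_def)
  moreover have "(\<lambda>t. Re (g t)) integrable_on {0..2*pi}"
    using integrable_linear[OF g bounded_linear_Re] by (simp add: o_def)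
  moreover have "(\<lambda>t. (cmod (v t))\<^sup>2) integrable_on {0..2*pi}"
    using v by (intro integrable_continuous_real continuous_intros)
  moreover have "integral {0..2*pi} g = cnj c * (2 * pi * fourier_coeff v m)"
    by (simp add: g_def[abs_def] fourier_coeff_def)
  ultimately have "integral {0..2*pi} (\<lambda>t. (cmod (v t - c * cis (of_int m * t)))\<^sup>2)
    = integral {0..2*pi} (\<lambda>t. (cmod (v t))\<^sup>2) - 2 * Re (cnj c * (2 * pi * fourier_coeff v m))
      + 2 * pi * (cmod c)\<^sup>2"
    by (simp only: integral_add integral_diff integrable_diff integrable_on_mult_right
        integral_mult_right integrable_const_ivl) simp
  then show ?thesis
    unfolding norm_diff_power2[of c] by (simp add: algebra_simps)
qed

text \<open>Monomials are subtracted one at a time; by orthogonality this leaves the coefficients at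
  the other frequencies unchanged. The identity yields both Bessel's inequality and the optimality
  of Fourier partial sums.\<close>

lemma integral_norm_diff_trig_sum:
  assumes "finite A" "continuous_on {0..2*pi} v"
  shows "integral {0..2*pi} (\<lambda>t. (cmod (v t - (\<Sum>m\<in>A. c m * cis (of_int m * t))))\<^sup>2)
    = integral {0..2*pi} (\<lambda>t. (cmod (v t))\<^sup>2)
      + 2 * pi * (\<Sum>m\<in>A. (cmod (c m - fourier_coeff v m))\<^sup>2 - (cmod (fourier_coeff v m))\<^sup>2)"
  using assms
proof (induction A arbitrary: v)
  case (insert a A)
  let ?v = "\<lambda>t. v t - c a * cis (of_int a * t)"
  have cont: "continuous_on {0..2*pi} ?v"
    using insert.prems by (intro continuous_intros)
  have "fourier_coeff ?v m = fourier_coeff v m" if "m \<in> A" for m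
    using insert.prems insert.hyps that
    by (subst fourier_coeff_diff) (auto simp: fourier_coeff_cmult fourier_coeff_cis intro!: continuous_intros)
  then have *: "(\<Sum>m\<in>A. (cmod (c m - fourier_coeff ?v m))\<^sup>2 - (cmod (fourier_coeff ?v m))\<^sup>2)
      = (\<Sum>m\<in>A. (cmod (c m - fourier_coeff v m))\<^sup>2 - (cmod (fourier_coeff v m))\<^sup>2)"
    by (intro sum.cong) auto
  have "integral {0..2*pi} (\<lambda>t. (cmod (v t - (\<Sum>m\<in>insert a A. c m * cis (of_int m * t))))\<^sup>2)
      = integral {0..2*pi} (\<lambda>t. (cmod (?v t - (\<Sum>m\<in>A. c m * cis (of_int m * t))))\<^sup>2)"
    using insert.hyps by (simp add: algebra_simps)
  also have "\<dots> = integral {0..2*pi} (\<lambda>t. (cmod (?v t))\<^sup>2)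
      + 2 * pi * (\<Sum>m\<in>A. (cmod (c m - fourier_coeff v m))\<^sup>2 - (cmod (fourier_coeff v m))\<^sup>2)"
    by (subst insert.IH[OF cont]) (simp add: *)
  also have "integral {0..2*pi} (\<lambda>t. (cmod (?v t))\<^sup>2) = integral {0..2*pi} (\<lambda>t. (cmod (v t))\<^sup>2)
      + 2 * pi * ((cmod (c a - fourier_coeff v a))\<^sup>2 - (cmod (fourier_coeff v a))\<^sup>2)"
    by (rule integral_norm_diff_trig_monomial[OF insert.prems])
  finally show ?case using insert.hyps by (simp add: algebra_simps)
qed simp

text \<open>The preceding identity with the Fourier coefficients as \<open>c\<close>: its left-hand
  side is nonnegative and the squares containing \<open>c\<close> vanish.\<close>

lemma bessel_inequality:
  assumes "finite A" "continuous_on {0..2*pi} v"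
  shows "2 * pi * (\<Sum>m\<in>A. (cmod (fourier_coeff v m))\<^sup>2) \<le> integral {0..2*pi} (\<lambda>t. (cmod (v t))\<^sup>2)"
proof -
  have "0 \<le> integral {0..2*pi} (\<lambda>t. (cmod (v t - (\<Sum>m\<in>A. fourier_coeff v m * cis (of_int m * t))))\<^sup>2)"
    using assms by (intro integral_nonneg integrable_continuous_real continuous_intros) auto
  then show ?thesis
    unfolding integral_norm_diff_trig_sum[OF assms] by (simp add: sum_negf)
qed

text \<open>Generated by sums rather than given as explicit finite sums, so that closure under
  products is a double induction without index bookkeeping.\<close>

inductive trig_poly :: "(real \<Rightarrow> complex) \<Rightarrow> bool" where
  monomial: "trig_poly (\<lambda>t. c * cis (of_int m * t))"
| add: "trig_poly f \<Longrightarrow> trig_poly g \<Longrightarrow> trig_poly (\<lambda>t. f t + g t)"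

lemma trig_poly_mult:
  assumes "trig_poly f" "trig_poly g" shows "trig_poly (\<lambda>t. f t * g t)"
  using assms(1)
proof induction
  case (monomial c m)
  from assms(2) show ?case
  proof induction
    case (monomial d n)
    have "(\<lambda>t. c * cis (of_int m * t) * (d * cis (of_int n * t)))
        = (\<lambda>t. (c * d) * cis (of_int (m + n) * t))"
      by (simp add: cis_mult[symmetric] algebra_simps)
    then show ?case by (simp only: trig_poly.monomial)
  qed (simp add: distrib_left trig_poly.add)
qed (simp add: distrib_right trig_poly.add)

lemma trig_poly_cmult: "trig_poly f \<Longrightarrow> trig_poly (\<lambda>t. c * f t)"
  using trig_poly_mult[OF trig_poly.monomial[of c 0]] by simp

text \<open>Any finite \<open>B\<close> containing \<open>A\<close> is allowed as index set because
  the constructed coefficients vanish off \<open>A\<close>. This brings two sums to a common index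
  set, here and in the use of Parseval for two functions at once.\<close>

lemma trig_poly_eq_sum:
  assumes "trig_poly f"
  shows "\<exists>A c. finite A \<and> (\<forall>B t. finite B \<longrightarrow> A \<subseteq> B \<longrightarrow> f t = (\<Sum>m\<in>B. c m * cis (of_int m * t)))"
  using assms
proof induction
  case (monomial c m)
  have "c * cis (of_int m * t) = (\<Sum>k\<in>B. (if k = m then c else 0) * cis (of_int k * t))"
    if "finite B" "{m} \<subseteq> B" for B t
    using that by (simp add: if_distrib[of "\<lambda>x. x * _"] sum.delta cong: if_cong)
  then have "finite {m} \<and> (\<forall>B t. finite B \<longrightarrow> {m} \<subseteq> B \<longrightarrow>
      c * cis (of_int m * t) = (\<Sum>k\<in>B. (if k = m then c else 0) * cis (of_int k * t)))"
    by (intro conjI allI impI finite.intros)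
  then show ?case
    by - (rule exI[of _ "{m}"], rule exI[of _ "\<lambda>k. if k = m then c else 0"], assumption)
next
  case (add f g)
  obtain A c where f: "finite A \<and> (\<forall>B t. finite B \<longrightarrow> A \<subseteq> B \<longrightarrow> f t = (\<Sum>m\<in>B. c m * cis (of_int m * t)))"
    using add.IH(1) by (elim exE)
  obtain A' c' where g: "finite A' \<and> (\<forall>B t. finite B \<longrightarrow> A' \<subseteq> B \<longrightarrow> g t = (\<Sum>m\<in>B. c' m * cis (of_int m * t)))"
    using add.IH(2) by (elim exE)
  have "f t + g t = (\<Sum>m\<in>B. (c m + c' m) * cis (of_int m * t))" if "finite B" "A \<union> A' \<subseteq> B" for B t
  proof -
    have "f t = (\<Sum>m\<in>B. c m * cis (of_int m * t))" using f that by simp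
    moreover have "g t = (\<Sum>m\<in>B. c' m * cis (of_int m * t))" using g that by simp
    ultimately show ?thesis by (simp add: distrib_right sum.distrib)
  qed
  then have "finite (A \<union> A') \<and> (\<forall>B t. finite B \<longrightarrow> A \<union> A' \<subseteq> B \<longrightarrow>
      f t + g t = (\<Sum>m\<in>B. (c m + c' m) * cis (of_int m * t)))"
    using f g by (intro conjI allI impI) simp_all
  then show ?case
    by - (rule exI[of _ "A \<union> A'"], rule exI[of _ "\<lambda>m. c m + c' m"], assumption)
qed

text \<open>A real-linear functional on the complex plane, restricted to the circle, is a
  combination of \<open>cos t\<close> and \<open>sin t\<close>, hence of \<open>cis t\<close> and
  \<open>cis (- t)\<close>; sums and products stay trigonometric.\<close>

lemma trig_poly_real_polynomial:
  assumes "real_polynomial_function p" shows "trig_poly (\<lambda>t. of_real (p (cis t)))"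
  using assms
proof induction
  case (linear f)
  interpret bounded_linear f by fact
  have "f (cis t) = cos t * f 1 + sin t * f \<i>" for t
  proof -
    have "cis t = cos t *\<^sub>R 1 + sin t *\<^sub>R \<i>" by (simp add: complex_eq_iff)
    then show ?thesis by (simp only: add scaleR) simp
  qed
  then have "of_real (f (cis t)) = of_real (f 1) * ((1/2) * cis (of_int 1 * t) + (1/2) * cis (of_int (-1) * t))
      + of_real (f \<i>) * ((- \<i>/2) * cis (of_int 1 * t) + (\<i>/2) * cis (of_int (-1) * t))" for t
    by (simp add: complex_eq_iff)
  moreover have "trig_poly (\<lambda>t. of_real (f 1) * ((1/2) * cis (of_int 1 * t) + (1/2) * cis (of_int (-1) * t))
      + of_real (f \<i>) * ((- \<i>/2) * cis (of_int 1 * t) + (\<i>/2) * cis (of_int (-1) * t)))"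
    by (intro trig_poly.intros trig_poly_cmult)
  ultimately show ?case by presburger
next
  case (const c)
  show ?case using trig_poly.monomial[of "of_real c" 0] by simp
qed (simp_all add: trig_poly.add trig_poly_mult)

text \<open>Stone-Weierstrass on the circle, for the real and the imaginary part separately with
  error \<open>e / 2\<close> each.\<close>

lemma trig_poly_dense:
  assumes V: "continuous_on (sphere 0 1) V" and e: "e > 0"
  obtains T where "trig_poly T" "\<And>t. cmod (V (cis t) - T t) < e"
proof -
  have e2: "e / 2 > 0" using e by simp
  have "continuous_on (sphere 0 1) (\<lambda>z. Re (V z))" "continuous_on (sphere 0 1) (\<lambda>z. Im (V z))"
    by (intro continuous_intros V)+
  then obtain p q where p: "real_polynomial_function p" "\<And>z. z \<in> sphere 0 1 \<Longrightarrow> \<bar>Re (V z) - p z\<bar> < e/2"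
    and q: "real_polynomial_function q" "\<And>z. z \<in> sphere 0 1 \<Longrightarrow> \<bar>Im (V z) - q z\<bar> < e/2"
    using Stone_Weierstrass_real_polynomial_function[OF compact_sphere _ e2] by metis
  show ?thesis
  proof
    show "trig_poly (\<lambda>t. of_real (p (cis t)) + \<i> * of_real (q (cis t)))"
      by (intro trig_poly.add trig_poly_cmult trig_poly_real_polynomial p q)
    fix t
    have t: "cis t \<in> sphere 0 1" by simp
    have "\<bar>Re (V (cis t)) - p (cis t)\<bar> + \<bar>Im (V (cis t)) - q (cis t)\<bar> < e"
      using p(2)[OF t] q(2)[OF t] by linarith
    then show "cmod (V (cis t) - (of_real (p (cis t)) + \<i> * of_real (q (cis t)))) < e"
      using cmod_le[of "V (cis t) - (of_real (p (cis t)) + \<i> * of_real (q (cis t)))"] by simp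
  qed
qed

lemma continuous_on_circle:
  assumes "continuous_on (sphere 0 1) V" shows "continuous_on X (\<lambda>t. V (cis t))"
  by (rule continuous_on_compose2[OF assms]) (auto intro: continuous_intros)

text \<open>The Fourier partial sum is the best approximation among trigonometric polynomials with
  frequencies in \<open>B\<close>, so density of the latter yields Parseval's identity.\<close>

lemma parseval_approx:
  assumes V: "continuous_on (sphere 0 1) V" and e: "e > 0"
  obtains A where "finite A" "\<And>B. finite B \<Longrightarrow> A \<subseteq> B \<Longrightarrow>
    integral {0..2*pi} (\<lambda>t. (cmod (V (cis t)))\<^sup>2) - e
      \<le> 2 * pi * (\<Sum>m\<in>B. (cmod (fourier_coeff (\<lambda>t. V (cis t)) m))\<^sup>2)"
proof -
  \<comment> \<open>A uniform error \<open>d\<close> contributes at most \<open>2 pi d^2 = e\<close>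
    to the integral of the squared error.\<close>
  define d where "d = sqrt (e / (2 * pi))"
  have d: "d > 0" "2 * pi * d\<^sup>2 = e" using e by (simp_all add: d_def)
  obtain T where T: "trig_poly T" "\<And>t. cmod (V (cis t) - T t) < d"
    using trig_poly_dense[OF V d(1)] by blast
  obtain A c where A: "finite A" "\<And>B t. finite B \<Longrightarrow> A \<subseteq> B \<Longrightarrow> T t = (\<Sum>m\<in>B. c m * cis (of_int m * t))"
  proof -
    obtain A c where "finite A \<and> (\<forall>B t. finite B \<longrightarrow> A \<subseteq> B \<longrightarrow> T t = (\<Sum>m\<in>B. c m * cis (of_int m * t)))"
      using trig_poly_eq_sum[OF T(1)] by (elim exE)
    then show thesis by (intro that[of A c]) simp_all
  qed
  note cont = continuous_on_circle[OF V]
  show ?thesis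
  proof (rule that[OF A(1)])
    fix B assume B: "finite B" "A \<subseteq> B"
    have "integral {0..2*pi} (\<lambda>t. (cmod (V (cis t) - (\<Sum>m\<in>B. c m * cis (of_int m * t))))\<^sup>2)
        \<le> integral {0..2*pi} (\<lambda>t. d\<^sup>2)"
    proof (rule integral_le)
      show "(\<lambda>t. (cmod (V (cis t) - (\<Sum>m\<in>B. c m * cis (of_int m * t))))\<^sup>2) integrable_on {0..2*pi}"
        by (intro integrable_continuous_real continuous_intros cont)
      show "(cmod (V (cis t) - (\<Sum>m\<in>B. c m * cis (of_int m * t))))\<^sup>2 \<le> d\<^sup>2" for t
        using T(2)[of t] A(2)[OF B, of t] by (intro power_mono) auto
    qed auto
    also have "\<dots> = e" using d by simp
    finally have "integral {0..2*pi} (\<lambda>t. (cmod (V (cis t)))\<^sup>2) - e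
        \<le> 2 * pi * (\<Sum>m\<in>B. (cmod (fourier_coeff (\<lambda>t. V (cis t)) m))\<^sup>2)
          - 2 * pi * (\<Sum>m\<in>B. (cmod (c m - fourier_coeff (\<lambda>t. V (cis t)) m))\<^sup>2)"
      unfolding integral_norm_diff_trig_sum[OF B(1) cont] by (simp add: sum_subtractf algebra_simps)
    also have "\<dots> \<le> 2 * pi * (\<Sum>m\<in>B. (cmod (fourier_coeff (\<lambda>t. V (cis t)) m))\<^sup>2)"
      by (simp add: sum_nonneg)
    finally show "integral {0..2*pi} (\<lambda>t. (cmod (V (cis t)))\<^sup>2) - e
      \<le> 2 * pi * (\<Sum>m\<in>B. (cmod (fourier_coeff (\<lambda>t. V (cis t)) m))\<^sup>2)" .
  qed
qed

text \<open>Integration by parts against \<open>cis (- m t)\<close>; the boundary terms cancel by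
  periodicity.\<close>

lemma fourier_coeff_derivative:
  assumes d: "\<And>t. (v has_vector_derivative v' t) (at t)" and v': "continuous_on {0..2*pi} v'"
    and per: "v (2 * pi) = v 0"
  shows "fourier_coeff v' m = \<i> * of_int m * fourier_coeff v m"
proof -
  have v: "continuous_on {0..2*pi} v"
    using d by (meson continuous_at_imp_continuous_on has_vector_derivative_continuous)
  let ?e = "\<lambda>t. cis (- (of_int m * t))"
  have e: "(?e has_vector_derivative - (\<i> * of_int m * ?e t)) (at t within {0..2*pi})" for t
    using has_vector_derivative_cis[of "- of_int m" t "{0..2*pi}"] by simp
  have "((\<lambda>t. v t * - (\<i> * of_int m * ?e t) + v' t * ?e t) has_integral
      v (2 * pi) * ?e (2 * pi) - v 0 * ?e 0) {0..2*pi}"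
    by (intro fundamental_theorem_of_calculus has_vector_derivative_mult e
        has_vector_derivative_at_within[OF d]) simp
  moreover have "?e (2 * pi) = 1" using cis_of_int_2pi[of "- m"] by simp
  ultimately have "integral {0..2*pi} (\<lambda>t. v t * - (\<i> * of_int m * ?e t) + v' t * ?e t) = 0"
    using per by (simp add: integral_unique)
  moreover have "integral {0..2*pi} (\<lambda>t. v t * - (\<i> * of_int m * ?e t) + v' t * ?e t)
      = integral {0..2*pi} (\<lambda>t. - (\<i> * of_int m) * (v t * ?e t)) + integral {0..2*pi} (\<lambda>t. v' t * ?e t)"
    using v v' by (subst integral_add[symmetric])
      (auto simp: mult_ac intro!: integrable_continuous_real continuous_intros)
  ultimately show ?thesis
    by (simp add: fourier_coeff_def)
qed

text \<open>Here \<open>V'\<close> and \<open>V''\<close> are not derivatives but the images of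
  \<open>V\<close> under \<open>d/dt - i \<Psi>\<close> and its square. On Fourier coefficients this
  operator is multiplication by \<open>i (m - \<Psi>)\<close>, so the claim reduces to
  \<open>C (1 + x) \<le> (1 - x)^2\<close> with \<open>x = (m - \<Psi>)^2\<close> for each
  frequency.\<close>

lemma circle_operator_inequality:
  fixes \<Psi> C :: real and V V' V'' :: "complex \<Rightarrow> complex"
  assumes cont: "continuous_on (sphere 0 1) V" "continuous_on (sphere 0 1) V'" "continuous_on (sphere 0 1) V''"
    and d1: "\<And>t. ((\<lambda>t. V (cis t)) has_vector_derivative V' (cis t) + \<i> * \<Psi> * V (cis t)) (at t)"
    and d2: "\<And>t. ((\<lambda>t. V' (cis t)) has_vector_derivative V'' (cis t) + \<i> * \<Psi> * V' (cis t)) (at t)"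
    and C: "0 \<le> C" "\<And>m. C \<le> AB_quotient \<Psi> m"
  shows "C * (integral {0..2*pi} (\<lambda>t. (cmod (V (cis t)))\<^sup>2) + integral {0..2*pi} (\<lambda>t. (cmod (V' (cis t)))\<^sup>2))
    \<le> integral {0..2*pi} (\<lambda>t. (cmod (V (cis t) + V'' (cis t)))\<^sup>2)"
proof -
  note c = continuous_on_circle[OF cont(1)] continuous_on_circle[OF cont(2)] continuous_on_circle[OF cont(3)]
  let ?f = "fourier_coeff (\<lambda>t. V (cis t))"
  have step: "fourier_coeff (\<lambda>t. W' (cis t)) m = \<i> * (m - \<Psi>) * fourier_coeff (\<lambda>t. W (cis t)) m"
    if W: "continuous_on {0..2*pi} (\<lambda>t. W (cis t))" "continuous_on {0..2*pi} (\<lambda>t. W' (cis t))"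
      and d: "\<And>t. ((\<lambda>t. W (cis t)) has_vector_derivative W' (cis t) + \<i> * \<Psi> * W (cis t)) (at t)"
    for W W' :: "complex \<Rightarrow> complex" and m :: int
  proof -
    have "fourier_coeff (\<lambda>t. W' (cis t) + \<i> * \<Psi> * W (cis t)) m = \<i> * of_int m * fourier_coeff (\<lambda>t. W (cis t)) m"
      using W by (intro fourier_coeff_derivative d continuous_intros) auto
    moreover have "fourier_coeff (\<lambda>t. W' (cis t) - (- \<i> * \<Psi>) * W (cis t)) m
        = fourier_coeff (\<lambda>t. W' (cis t)) m - (- \<i> * \<Psi>) * fourier_coeff (\<lambda>t. W (cis t)) m"
      using W by (subst fourier_coeff_diff) (auto simp only: fourier_coeff_cmult intro!: continuous_intros)
    ultimately show ?thesis by (simp add: algebra_simps)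
  qed
  have f1: "fourier_coeff (\<lambda>t. V' (cis t)) m = \<i> * (m - \<Psi>) * ?f m" for m
    by (rule step[OF c(1,2) d1])
  have f2: "fourier_coeff (\<lambda>t. V'' (cis t)) m = - ((m - \<Psi>)\<^sup>2 * ?f m)" for m
    unfolding step[OF c(2,3) d2] f1 by (simp add: complex_eq_iff power2_eq_square algebra_simps)
  have f02: "fourier_coeff (\<lambda>t. V (cis t) + V'' (cis t)) m = of_real (1 - (m - \<Psi>)\<^sup>2) * ?f m" for m
  proof -
    have "fourier_coeff (\<lambda>t. V (cis t) - (-1) * V'' (cis t)) m = ?f m - (-1) * fourier_coeff (\<lambda>t. V'' (cis t)) m"
      using c by (subst fourier_coeff_diff) (auto simp only: fourier_coeff_cmult intro!: continuous_intros)
    then show ?thesis by (simp add: f2 algebra_simps)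
  qed
  have symbol: "C * (1 + (m - \<Psi>)\<^sup>2) \<le> (1 - (m - \<Psi>)\<^sup>2)\<^sup>2" for m :: int
  proof -
    \<comment> \<open>The eigenvalues involve \<open>m - \<Psi>\<close> and the quotient
      \<open>m + \<Psi>\<close>, so the bound on \<open>C\<close> is used at
      \<open>- m\<close>.\<close>
    have "(of_int (- m) + \<Psi>)\<^sup>2 = (m - \<Psi>)\<^sup>2" by (simp add: power2_eq_square algebra_simps)
    then have "C \<le> ((m - \<Psi>)\<^sup>2 - 1)\<^sup>2 / ((m - \<Psi>)\<^sup>2 + 1)"
      using C(2)[of "- m"] unfolding AB_quotient_def by metis
    then show ?thesis
      by (simp add: pos_le_divide_eq add_pos_nonneg add.commute power2_commute)
  qed
  show ?thesis
  \<comment> \<open>Finite sums connect the two sides: Parseval bounds the left-hand integrals by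
    sums up to a small error, and Bessel bounds the sum for \<open>V + V''\<close> by the right-hand
    integral.\<close>
  proof (rule field_le_epsilon)
    fix e :: real assume "e > 0"
    \<comment> \<open>Two Parseval errors are multiplied by \<open>C\<close>; the summand
      \<open>1\<close> keeps the denominator positive when \<open>C = 0\<close>.\<close>
    define \<epsilon> where "\<epsilon> = e / (2 * C + 1)"
    have \<epsilon>: "\<epsilon> > 0" "2 * C * \<epsilon> \<le> e"
      using \<open>e > 0\<close> C(1) by (simp_all add: \<epsilon>_def field_simps)
    obtain A0 where A0: "finite A0" "\<And>B. finite B \<Longrightarrow> A0 \<subseteq> B \<Longrightarrow>
        integral {0..2*pi} (\<lambda>t. (cmod (V (cis t)))\<^sup>2) - \<epsilon> \<le> 2 * pi * (\<Sum>m\<in>B. (cmod (?f m))\<^sup>2)"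
      using parseval_approx[OF cont(1) \<epsilon>(1)] by blast
    obtain A1 where A1: "finite A1" "\<And>B. finite B \<Longrightarrow> A1 \<subseteq> B \<Longrightarrow>
        integral {0..2*pi} (\<lambda>t. (cmod (V' (cis t)))\<^sup>2) - \<epsilon>
        \<le> 2 * pi * (\<Sum>m\<in>B. (cmod (fourier_coeff (\<lambda>t. V' (cis t)) m))\<^sup>2)"
      using parseval_approx[OF cont(2) \<epsilon>(1)] by blast
    define B where "B = A0 \<union> A1"
    have B: "finite B" using A0 A1 by (simp add: B_def)
    have "integral {0..2*pi} (\<lambda>t. (cmod (V (cis t)))\<^sup>2) + integral {0..2*pi} (\<lambda>t. (cmod (V' (cis t)))\<^sup>2) - 2 * \<epsilon>
        \<le> 2 * pi * (\<Sum>m\<in>B. (cmod (?f m))\<^sup>2) + 2 * pi * (\<Sum>m\<in>B. (cmod (fourier_coeff (\<lambda>t. V' (cis t)) m))\<^sup>2)"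
      using A0(2)[OF B] A1(2)[OF B] by (simp add: B_def)
    also have "\<dots> = 2 * pi * (\<Sum>m\<in>B. (1 + (m - \<Psi>)\<^sup>2) * (cmod (?f m))\<^sup>2)"
      unfolding f1 by (simp add: norm_mult power_mult_distrib sum.distrib algebra_simps flip: of_real_diff)
    finally have "C * (integral {0..2*pi} (\<lambda>t. (cmod (V (cis t)))\<^sup>2) + integral {0..2*pi} (\<lambda>t. (cmod (V' (cis t)))\<^sup>2) - 2 * \<epsilon>)
        \<le> C * (2 * pi * (\<Sum>m\<in>B. (1 + (m - \<Psi>)\<^sup>2) * (cmod (?f m))\<^sup>2))"
      using C(1) by (rule mult_left_mono)
    also have "\<dots> = 2 * pi * (\<Sum>m\<in>B. (C * (1 + (m - \<Psi>)\<^sup>2)) * (cmod (?f m))\<^sup>2)"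
      by (simp add: sum_distrib_left mult_ac)
    also have "\<dots> \<le> 2 * pi * (\<Sum>m\<in>B. (1 - (m - \<Psi>)\<^sup>2)\<^sup>2 * (cmod (?f m))\<^sup>2)"
      by (intro mult_left_mono sum_mono mult_right_mono symbol) auto
    also have "\<dots> = 2 * pi * (\<Sum>m\<in>B. (cmod (fourier_coeff (\<lambda>t. V (cis t) + V'' (cis t)) m))\<^sup>2)"
      unfolding f02 norm_mult norm_of_real power_mult_distrib by simp
    also have "\<dots> \<le> integral {0..2*pi} (\<lambda>t. (cmod (V (cis t) + V'' (cis t)))\<^sup>2)"
      using c by (intro bessel_inequality B continuous_intros)
    finally show "C * (integral {0..2*pi} (\<lambda>t. (cmod (V (cis t)))\<^sup>2) + integral {0..2*pi} (\<lambda>t. (cmod (V' (cis t)))\<^sup>2))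
        \<le> integral {0..2*pi} (\<lambda>t. (cmod (V (cis t) + V'' (cis t)))\<^sup>2) + e"
      using \<epsilon>(2) by (simp add: algebra_simps)
  qed
qed

section \<open>The constant: existence of the minimum and bounds\<close>

text \<open>Division with remainder: for \<open>x = (m + \<Psi>)^2\<close> the quotient equals
  \<open>x - 3 + 4 / (x + 1)\<close>. Hence it tends to infinity with \<open>m\<close> in both
  directions.\<close>

lemma AB_quotient_ge: "(of_int m + \<Psi>)\<^sup>2 - 3 \<le> AB_quotient \<Psi> m"
proof -
  define x where "x = (of_int m + \<Psi>)\<^sup>2"
  have "x \<ge> 0" by (simp add: x_def)
  then have "(x - 3) * (x + 1) \<le> (x - 1)\<^sup>2" by (simp add: power2_eq_square algebra_simps)
  then show ?thesis
    using \<open>x \<ge> 0\<close> by (simp add: AB_quotient_def x_def[symmetric] pos_le_divide_eq)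
qed

text \<open>By growth at infinity, the integers whose quotient is at most the one at
  \<open>0\<close> form a finite set; a minimiser on this set is a global one.\<close>

lemma AB_quotient_minimum: "\<exists>m0. \<forall>m. AB_quotient \<Psi> m0 \<le> AB_quotient \<Psi> m"
proof -
  let ?S = "{m. AB_quotient \<Psi> m \<le> AB_quotient \<Psi> 0}"
  \<comment> \<open>From \<open>y^2 \<le> AB_quotient \<Psi> 0 + 3\<close> and
    \<open>2 y \<le> y^2 + 1\<close> follows \<open>y \<le> AB_quotient \<Psi> 0 + 4\<close>; the
    last summand accounts for the shift of \<open>m\<close> by \<open>\<Psi>\<close>.\<close>
  define b where "b = AB_quotient \<Psi> 0 + 4 + \<bar>\<Psi>\<bar>"
  have "\<bar>of_int m\<bar> \<le> b" if "m \<in> ?S" for m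
  proof -
    define y where "y = \<bar>of_int m + \<Psi>\<bar>"
    have "y\<^sup>2 \<le> AB_quotient \<Psi> 0 + 3"
      using that AB_quotient_ge[of m \<Psi>] by (simp add: y_def)
    moreover have "2 * y \<le> y\<^sup>2 + 1"
      using sum_squares_bound[of y 1] by simp
    moreover have "\<bar>of_int m\<bar> \<le> y + \<bar>\<Psi>\<bar>" unfolding y_def by linarith
    moreover have "0 \<le> y" by (simp add: y_def)
    ultimately show ?thesis unfolding b_def by linarith
  qed
  then have "?S \<subseteq> {- \<lceil>b\<rceil>..\<lceil>b\<rceil>}"
    by (auto simp: abs_le_iff) (smt (verit) le_of_int_ceiling of_int_le_iff of_int_minus)+
  then have fin: "finite ?S" using finite_subset by blast
  have "Min (AB_quotient \<Psi> ` ?S) \<in> AB_quotient \<Psi> ` ?S"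
    using fin by (intro Min_in) auto
  then obtain m0 where m0: "m0 \<in> ?S" "AB_quotient \<Psi> m0 = Min (AB_quotient \<Psi> ` ?S)"
    by auto
  have "AB_quotient \<Psi> m0 \<le> AB_quotient \<Psi> m" for m
  proof (cases "m \<in> ?S")
    case True
    then show ?thesis using m0 fin by simp
  next
    case False
    then show ?thesis using m0 by simp
  qed
  then show ?thesis by blast
qed

lemma C_AB_attained: "C_AB \<Psi> \<in> range (AB_quotient \<Psi>)"
  and C_AB_le: "C_AB \<Psi> \<le> AB_quotient \<Psi> m"
proof -
  obtain m0 where m0: "\<And>m. AB_quotient \<Psi> m0 \<le> AB_quotient \<Psi> m"
    using AB_quotient_minimum by blast
  have "C_AB \<Psi> = AB_quotient \<Psi> m0"
    unfolding C_AB_def using m0 by (intro Least_equality) auto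
  then show "C_AB \<Psi> \<in> range (AB_quotient \<Psi>)" "C_AB \<Psi> \<le> AB_quotient \<Psi> m"
    using m0 by auto
qed

lemma C_AB_nonneg: "0 \<le> C_AB \<Psi>"
  using C_AB_attained[of \<Psi>] by (auto simp: AB_quotient_def)

text \<open>Tested at the integer nearest to \<open>- \<Psi>\<close>, where
  \<open>x = (m + \<Psi>)^2\<close> lies in \<open>[0,1]\<close> and so
  \<open>(x - 1)^2 \<le> 1 \<le> x + 1\<close>. The bound controls the dilation part of the
  gradient.\<close>

lemma C_AB_le_1: "C_AB \<Psi> \<le> 1"
proof -
  define x where "x = (of_int (round (- \<Psi>)) + \<Psi>)\<^sup>2"
  have "\<bar>of_int (round (- \<Psi>)) + \<Psi>\<bar> \<le> 1"
    using of_int_round_abs_le[of "- \<Psi>"] by simp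
  then have "0 \<le> x" "x \<le> 1" by (auto simp: x_def abs_square_le_1)
  then have "(x - 1)\<^sup>2 \<le> 1"
    by (simp add: abs_square_le_1)
  then have "(x - 1)\<^sup>2 / (x + 1) \<le> 1"
    using \<open>0 \<le> x\<close> by (simp add: divide_le_eq_1)
  then show ?thesis
    using C_AB_le[of \<Psi> "round (- \<Psi>)"] by (simp add: AB_quotient_def x_def)
qed

subsection \<open>The dilation and rotation operators\<close>

abbreviation punctured :: "(real^2) set" where
  "punctured \<equiv> - {0}"

lemma open_punctured: "open punctured"
  by (simp add: open_Compl)

lemma test_functions_punctured_zero: "f \<in> test_functions punctured \<Longrightarrow> f 0 = 0"
  by (rule test_functions_outside_support) (use test_functionsD(3) in blast)

lemmas punctured_differentiable = test_functions_differentiable[OF open_punctured]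
lemmas punctured_continuous = test_functions_continuous[OF open_punctured]
lemmas punctured_mult = test_functions_mult[OF open_punctured]
lemmas punctured_add = test_functions_add[OF open_punctured]
lemmas punctured_partial_deriv = test_functions_partial_deriv[OF open_punctured]

lemma punctured_coordinate:
  "f \<in> test_functions punctured \<Longrightarrow> (\<lambda>x. of_real (x $ k) * f x) \<in> test_functions punctured"
  by (intro punctured_mult smooth_on_coordinate)

lemma punctured_cmult:
  "f \<in> test_functions punctured \<Longrightarrow> (\<lambda>x. c * f x) \<in> test_functions punctured"
  by (intro punctured_mult smooth_on_const)

lemma punctured_diff:
  assumes "f \<in> test_functions punctured" "g \<in> test_functions punctured"
  shows "(\<lambda>x. f x - g x) \<in> test_functions punctured"
  using punctured_add[OF assms(1) punctured_cmult[OF assms(2), of "-1"]] by simp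

lemma partial_deriv_cmult:
  assumes "f differentiable (at x)"
  shows "partial_deriv j (\<lambda>x. c * f x) x = c * partial_deriv j f x"
  using partial_deriv_mult[OF differentiable_const[of c] assms] by simp

lemma partial_deriv_minus:
  assumes "f differentiable (at x)" "g differentiable (at x)"
  shows "partial_deriv j (\<lambda>x. f x - g x) x = partial_deriv j f x - partial_deriv j g x"
  using partial_deriv_add[OF assms(1) differentiable_minus[OF assms(2)], of j]
    partial_deriv_cmult[OF assms(2), of j "-1"] by simp

lemma differentiable_coordinate: "(\<lambda>x::real^'n::finite. complex_of_real (x $ k)) differentiable (at x)"
  using has_derivative_coordinate differentiableI by blast

lemma partial_deriv_coordinate_mult:
  assumes "f differentiable (at x)"
  shows "partial_deriv j (\<lambda>x::real^'n::finite. of_real (x $ k) * f x) x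
    = (if j = k then f x else 0) + of_real (x $ k) * partial_deriv j f x"
  using partial_deriv_mult[OF differentiable_coordinate assms] by (simp add: partial_deriv_coordinate)

text \<open>A complex polynomial in the coordinates, so that the smoothness and product rules apply
  directly.\<close>

definition radius2 :: "real^2 \<Rightarrow> complex" where
  "radius2 x = of_real (x $ 1) * of_real (x $ 1) + of_real (x $ 2) * of_real (x $ 2)"

lemma radius2_norm: "radius2 x = of_real ((norm x)\<^sup>2)"
  unfolding radius2_def power2_norm_vec2 by (simp add: power2_eq_square)

lemma radius2_eq_0_iff: "radius2 x = 0 \<longleftrightarrow> x = 0"
  by (simp add: radius2_norm)

lemma smooth_on_radius2: "smooth_on radius2 punctured"
  unfolding radius2_def[abs_def]
  by (intro smooth_on_add smooth_on_mult smooth_on_coordinate open_punctured)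

text \<open>The weight \<open>|x|^(-4)\<close>, with value \<open>0\<close> at the origin through
  \<open>inverse 0 = 0\<close>.\<close>

definition weight :: "real^2 \<Rightarrow> complex" where
  "weight x = inverse (radius2 x * radius2 x)"

lemma weight_norm: "weight x = of_real (1 / (norm x)^4)"
  by (simp add: weight_def radius2_norm power4_eq_xxxx power2_eq_square inverse_eq_divide)

lemma smooth_on_weight: "smooth_on weight punctured"
  unfolding weight_def[abs_def]
  by (intro smooth_on_inverse smooth_on_mult smooth_on_radius2 open_punctured) (simp add: radius2_eq_0_iff)

lemma partial_deriv_weight:
  assumes "x \<noteq> 0"
  shows "partial_deriv j weight x = - (4 * of_real (x $ j) * radius2 x * weight x * weight x)"
proof -
  have r: "radius2 differentiable (at x)"
    using assms smooth_on_differentiable_at[OF smooth_on_radius2 open_punctured] by simp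
  have "partial_deriv j radius2 x = 2 * of_real (x $ j)"
    unfolding radius2_def[abs_def]
    by (subst partial_deriv_add)
      (use exhaust_2[of j] in \<open>auto simp: partial_deriv_coordinate_mult partial_deriv_coordinate differentiable_coordinate
        intro!: differentiable_mult\<close>)
  then have "partial_deriv j (\<lambda>x. radius2 x * radius2 x) x = 4 * of_real (x $ j) * radius2 x"
    by (subst partial_deriv_mult[OF r r]) simp
  then show ?thesis
    unfolding weight_def[abs_def]
    by (subst partial_deriv_inverse) (use r assms in \<open>auto simp: radius2_eq_0_iff mult_ac intro!: differentiable_mult\<close>)
qed

text \<open>In polar coordinates \<open>radial\<close>, \<open>angular \<Psi>\<close> and
  \<open>radial1\<close> are \<open>r d/dr\<close>, \<open>d/d\<theta> - i \<Psi>\<close> and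
  \<open>r d/dr - 1\<close>: the operators \<open>R\<close>, \<open>L\<close> and \<open>B\<close>
  of the overview.\<close>

definition radial :: "(real^2 \<Rightarrow> complex) \<Rightarrow> real^2 \<Rightarrow> complex" where
  "radial f x = of_real (x $ 1) * partial_deriv 1 f x + of_real (x $ 2) * partial_deriv 2 f x"

definition angular :: "real \<Rightarrow> (real^2 \<Rightarrow> complex) \<Rightarrow> real^2 \<Rightarrow> complex" where
  "angular \<Psi> f x = of_real (x $ 1) * partial_deriv 2 f x - of_real (x $ 2) * partial_deriv 1 f x - \<i> * \<Psi> * f x"

definition radial1 :: "(real^2 \<Rightarrow> complex) \<Rightarrow> real^2 \<Rightarrow> complex" where
  "radial1 f x = radial f x - f x"

text \<open>The real part of the weighted inner product. Being real it is symmetric, so a skew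
  operator \<open>X\<close> satisfies \<open>form (X f) f = 0\<close>.\<close>

definition form :: "(real^2 \<Rightarrow> complex) \<Rightarrow> (real^2 \<Rightarrow> complex) \<Rightarrow> real" where
  "form u v = integral UNIV (\<lambda>x. Re (weight x * (u x * cnj (v x))))"

lemma punctured_radial: "f \<in> test_functions punctured \<Longrightarrow> radial f \<in> test_functions punctured"
  unfolding radial_def[abs_def] by (intro punctured_add punctured_coordinate punctured_partial_deriv)

lemma punctured_angular: "f \<in> test_functions punctured \<Longrightarrow> angular \<Psi> f \<in> test_functions punctured"
  unfolding angular_def[abs_def]
  by (intro punctured_diff punctured_coordinate punctured_cmult punctured_partial_deriv)

lemma punctured_radial1: "f \<in> test_functions punctured \<Longrightarrow> radial1 f \<in> test_functions punctured"
  unfolding radial1_def[abs_def] by (intro punctured_diff punctured_radial)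

lemma radial_add:
  "f \<in> test_functions punctured \<Longrightarrow> g \<in> test_functions punctured \<Longrightarrow>
    radial (\<lambda>x. f x + g x) = (\<lambda>x. radial f x + radial g x)"
  by (auto simp: radial_def partial_deriv_add punctured_differentiable algebra_simps)

lemma radial_diff:
  "f \<in> test_functions punctured \<Longrightarrow> g \<in> test_functions punctured \<Longrightarrow>
    radial (\<lambda>x. f x - g x) = (\<lambda>x. radial f x - radial g x)"
  by (auto simp: radial_def partial_deriv_minus punctured_differentiable algebra_simps)

lemma radial1_add:
  "f \<in> test_functions punctured \<Longrightarrow> g \<in> test_functions punctured \<Longrightarrow>
    radial1 (\<lambda>x. f x + g x) = (\<lambda>x. radial1 f x + radial1 g x)"
  by (auto simp: radial1_def radial_add algebra_simps)

lemma angular_diff: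
  "f \<in> test_functions punctured \<Longrightarrow> g \<in> test_functions punctured \<Longrightarrow>
    angular \<Psi> (\<lambda>x. f x - g x) = (\<lambda>x. angular \<Psi> f x - angular \<Psi> g x)"
  by (auto simp: angular_def partial_deriv_minus punctured_differentiable algebra_simps)

text \<open>Dilations commute with rotations. In coordinates the second-order terms match by the
  symmetry of the mixed partial derivatives.\<close>

lemma radial_angular_commute:
  assumes f: "f \<in> test_functions punctured"
  shows "radial (angular \<Psi> f) = angular \<Psi> (radial f)"
proof
  fix x
  note pd = punctured_partial_deriv[OF f]
  note d = punctured_differentiable[OF f] punctured_differentiable[OF pd]
    punctured_differentiable[OF punctured_coordinate[OF pd]] punctured_differentiable[OF punctured_cmult[OF f]]
    punctured_differentiable[OF punctured_diff[OF punctured_coordinate[OF pd] punctured_coordinate[OF pd]]]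
  have 1: "partial_deriv j (angular \<Psi> f) x
      = (if j = 1 then partial_deriv 2 f x else 0) + of_real (x $ 1) * partial_deriv j (partial_deriv 2 f) x
        - ((if j = 2 then partial_deriv 1 f x else 0) + of_real (x $ 2) * partial_deriv j (partial_deriv 1 f) x)
        - \<i> * \<Psi> * partial_deriv j f x" for j
    unfolding angular_def[abs_def]
    by (simp only: partial_deriv_minus d partial_deriv_coordinate_mult partial_deriv_cmult)
  have 2: "partial_deriv j (radial f) x
      = (if j = 1 then partial_deriv 1 f x else 0) + of_real (x $ 1) * partial_deriv j (partial_deriv 1 f) x
        + ((if j = 2 then partial_deriv 2 f x else 0) + of_real (x $ 2) * partial_deriv j (partial_deriv 2 f) x)" for j
    unfolding radial_def[abs_def]
    by (simp only: partial_deriv_add d partial_deriv_coordinate_mult)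
  have "partial_deriv 2 (partial_deriv 1 f) x = partial_deriv 1 (partial_deriv 2 f) x"
    by (rule partial_deriv_commute[OF f open_punctured])
  then show "radial (angular \<Psi> f) x = angular \<Psi> (radial f) x"
    unfolding radial_def[of "angular \<Psi> f"] angular_def[of \<Psi> "radial f"] 1 2 radial_def[of f] angular_def[of \<Psi> f]
    by (simp add: algebra_simps)
qed

lemma radial1_angular_commute:
  assumes f: "f \<in> test_functions punctured"
  shows "radial1 (angular \<Psi> f) = angular \<Psi> (radial1 f)"
  unfolding radial1_def[abs_def] angular_diff[OF punctured_radial[OF f] f] radial_angular_commute[OF f] ..

lemma punctured_form_integrand:
  assumes "u \<in> test_functions punctured" "v \<in> test_functions punctured"
  shows "(\<lambda>x. weight x * (u x * cnj (v x))) \<in> test_functions punctured"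
  using assms test_functionsD(1) test_functions_cnj[OF open_punctured]
  by (intro punctured_mult smooth_on_weight) blast+

lemma punctured_integrable:
  assumes "f \<in> test_functions punctured"
  shows "integrable lborel f" "f integrable_on UNIV"
proof -
  obtain M where M: "\<And>x. norm x > M \<Longrightarrow> f x = 0"
    using test_functions_bounded_support[OF assms] by blast
  show "integrable lborel f"
    by (rule integrable_lborel_bounded_support[OF punctured_continuous[OF assms] M])
  show "f integrable_on UNIV"
    using absolutely_integrable_bounded_support[OF punctured_continuous[OF assms] M]
      set_lebesgue_integral_eq_integral(1) by blast
qed

lemma integral_Re_punctured:
  assumes "f \<in> test_functions punctured"
  shows "(\<lambda>x. Re (f x)) integrable_on UNIV" "integral UNIV (\<lambda>x. Re (f x)) = Re (integral UNIV f)"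
  using integrable_linear[OF punctured_integrable(2)[OF assms] bounded_linear_Re]
    integral_linear[OF punctured_integrable(2)[OF assms] bounded_linear_Re]
  by (simp_all add: o_def)

lemma form_commute: "form u v = form v u"
  unfolding form_def by (intro integral_cong) (simp add: weight_norm algebra_simps)

lemma form_add_left:
  assumes "u \<in> test_functions punctured" "u' \<in> test_functions punctured" "v \<in> test_functions punctured"
  shows "form (\<lambda>x. u x + u' x) v = form u v + form u' v"
proof -
  have "Re (weight x * ((u x + u' x) * cnj (v x)))
      = Re (weight x * (u x * cnj (v x))) + Re (weight x * (u' x * cnj (v x)))" for x
    by (simp add: algebra_simps)
  then show ?thesis
    unfolding form_def
    by (simp only: integral_add integral_Re_punctured(1)[OF punctured_form_integrand] assms)
qed

lemma form_add_right:
  assumes "u \<in> test_functions punctured" "v \<in> test_functions punctured" "v' \<in> test_functions punctured"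
  shows "form u (\<lambda>x. v x + v' x) = form u v + form u v'"
  using form_add_left[OF assms(2,3,1)] by (simp add: form_commute)

lemma form_nonneg: "0 \<le> form u u"
  unfolding form_def
proof (cases "(\<lambda>x. Re (weight x * (u x * cnj (u x)))) integrable_on UNIV")
  case True
  then show "0 \<le> integral UNIV (\<lambda>x. Re (weight x * (u x * cnj (u x))))"
    by (rule integral_nonneg) (simp add: weight_norm complex_mult_cnj)
qed (simp add: not_integrable_integral)

lemma partial_deriv_form_integrand:
  assumes "u \<in> test_functions punctured" "v \<in> test_functions punctured" "x \<noteq> 0"
  shows "partial_deriv j (\<lambda>x. weight x * (u x * cnj (v x))) x =
    - (4 * of_real (x $ j) * radius2 x * weight x * weight x) * (u x * cnj (v x))
    + weight x * (partial_deriv j u x * cnj (v x) + u x * cnj (partial_deriv j v x))"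
proof -
  have u: "u differentiable (at x)" and v: "v differentiable (at x)"
    using assms punctured_differentiable by blast+
  have w: "weight differentiable (at x)"
    using assms(3) smooth_on_differentiable_at[OF smooth_on_weight open_punctured] by simp
  have "(\<lambda>x. u x * cnj (v x)) differentiable (at x)"
    by (intro differentiable_mult u differentiable_cnj v)
  with w show ?thesis
    by (simp only: partial_deriv_mult partial_deriv_weight[OF assms(3)] u v differentiable_cnj partial_deriv_cnj)
qed

text \<open>With \<open>F = u * cnj v / |x|^4\<close> the two integrands add up to the divergence of \<open>x F\<close>
  (the shift by \<open>1\<close> in \<open>radial1\<close> compensates \<open>div x = 2\<close> and the degree \<open>-4\<close> of the weight)
  and of the rotated field \<open>(- x\<^sub>2 F, x\<^sub>1 F)\<close>, respectively.\<close>

lemma form_skew: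
  assumes u: "u \<in> test_functions punctured" and v: "v \<in> test_functions punctured"
  shows form_radial1: "form (radial1 u) v = - form u (radial1 v)"
    and form_angular: "form (angular \<Psi> u) v = - form u (angular \<Psi> v)"
proof -
  define F where "F = (\<lambda>x. weight x * (u x * cnj (v x)))"
  have F: "F \<in> test_functions punctured"
    unfolding F_def by (rule punctured_form_integrand[OF u v])
  have div0: "integral UNIV (partial_deriv j (\<lambda>x. of_real (x $ k) * F x)) = 0" for j k
    by (rule integral_partial_deriv[OF punctured_coordinate[OF F] open_punctured])
  have divT: "partial_deriv j (\<lambda>x. of_real (x $ k) * F x) \<in> test_functions punctured" for j k
    by (intro punctured_partial_deriv punctured_coordinate F)
  have dF: "partial_deriv j (\<lambda>x. of_real (x $ k) * F x) x
    = (if j = k then F x else 0) + of_real (x $ k) * partial_deriv j F x" for j k x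
    by (rule partial_deriv_coordinate_mult[OF punctured_differentiable[OF F]])
  \<comment> \<open>Common to both operators: skewness follows once the two integrands add up to a
    function with integral \<open>0\<close>.\<close>
  have skew: "form (X u) v = - form u (X v)"
    if X: "X u \<in> test_functions punctured" "X v \<in> test_functions punctured"
      and div: "\<And>x. weight x * (X u x * cnj (v x)) + weight x * (u x * cnj (X v x)) = G x"
      and G: "G integrable_on UNIV" "integral UNIV G = 0" for X G
  proof -
    have "form (X u) v + form u (X v) = integral UNIV (\<lambda>x. Re (G x))"
      unfolding form_def
      using integral_Re_punctured(1)[OF punctured_form_integrand[OF X(1) v]]
        integral_Re_punctured(1)[OF punctured_form_integrand[OF u X(2)]]
      by (simp only: integral_add[symmetric] div[symmetric] plus_complex.sel)
    also have "\<dots> = Re (integral UNIV G)"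
      using integral_linear[OF G(1) bounded_linear_Re] by (simp add: o_def)
    finally show ?thesis using G(2) by simp
  qed
  have ww: "radius2 x * radius2 x * weight x = 1" if "x \<noteq> 0" for x
    unfolding weight_def by (rule right_inverse) (simp add: that radius2_eq_0_iff)
  show "form (radial1 u) v = - form u (radial1 v)"
  proof (rule skew[OF punctured_radial1[OF u] punctured_radial1[OF v]])
    let ?G = "\<lambda>x. partial_deriv 1 (\<lambda>x. of_real (x $ 1) * F x) x + partial_deriv 2 (\<lambda>x. of_real (x $ 2) * F x) x"
    show "?G integrable_on UNIV" "integral UNIV ?G = 0"
      using punctured_integrable(2)[OF divT] div0 by (auto simp: integral_add intro: integrable_add)
    show "weight x * (radial1 u x * cnj (v x)) + weight x * (u x * cnj (radial1 v x)) = ?G x" for x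
    \<comment> \<open>At the origin both sides are \<open>0\<close>: on the left
      \<open>weight 0 = 0\<close>, and on the right the derivatives are test functions supported
      away from the origin.\<close>
    proof (cases "x = 0")
      case True
      then show ?thesis
        using test_functions_punctured_zero[OF divT] by (simp add: weight_def radius2_def)
    next
      case False
      have "?G x = 2 * F x - 4 * (radius2 x * radius2 x * weight x) * F x
        + weight x * (radial u x * cnj (v x) + u x * cnj (radial v x))"
        unfolding dF unfolding F_def partial_deriv_form_integrand[OF u v False] radial_def
        by (simp add: radius2_def algebra_simps)
      then show ?thesis
        unfolding ww[OF False] by (simp add: radial1_def F_def algebra_simps)
    qed
  qed
  show "form (angular \<Psi> u) v = - form u (angular \<Psi> v)"
  proof (rule skew[OF punctured_angular[OF u] punctured_angular[OF v]])
    let ?G = "\<lambda>x. partial_deriv 2 (\<lambda>x. of_real (x $ 1) * F x) x - partial_deriv 1 (\<lambda>x. of_real (x $ 2) * F x) x"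
    show "?G integrable_on UNIV" "integral UNIV ?G = 0"
      using punctured_integrable(2)[OF divT] div0 by (auto simp: integral_diff intro: integrable_diff)
    show "weight x * (angular \<Psi> u x * cnj (v x)) + weight x * (u x * cnj (angular \<Psi> v x)) = ?G x" for x
    proof (cases "x = 0")
      case True
      then show ?thesis
        using test_functions_punctured_zero[OF divT] by (simp add: weight_def radius2_def)
    next
      case False
      then show ?thesis
        unfolding dF unfolding F_def partial_deriv_form_integrand[OF u v False] angular_def
        by (simp add: algebra_simps)
    qed
  qed
qed

section \<open>Averaging over rotations\<close>

text \<open>The angular derivative along a circle is \<open>angular \<Psi> f + i \<Psi> f\<close>,
  which is the relation between \<open>V\<close> and \<open>V'\<close> that
  \<open>circle_operator_inequality\<close> assumes.\<close>

lemma has_vector_derivative_rotate2: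
  assumes f: "f \<in> test_functions punctured"
  shows "((\<lambda>t. f (rotate2 (cis t) x)) has_vector_derivative
    angular \<Psi> f (rotate2 (cis t) x) + \<i> * \<Psi> * f (rotate2 (cis t) x)) (at t)"
proof -
  let ?y = "rotate2 (cis t) x"
  have rot: "rotate2 z x = (Re z * x $ 1 - Im z * x $ 2) *\<^sub>R axis 1 1 + (Im z * x $ 1 + Re z * x $ 2) *\<^sub>R axis 2 1"
    for z by (simp add: vec_eq_iff forall_2 axis_def)
  have "((\<lambda>t. rotate2 (cis t) x) has_derivative
      (\<lambda>h. h *\<^sub>R ((- (?y $ 2)) *\<^sub>R axis 1 1 + (?y $ 1) *\<^sub>R axis 2 1))) (at t)"
    unfolding rot[of "cis _"]
    by (auto intro!: derivative_eq_intros simp: vec_eq_iff forall_2 axis_def algebra_simps)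
  from has_derivative_compose[OF this has_derivative_partial_deriv[OF punctured_differentiable[OF f]]]
  have "((\<lambda>t. f (rotate2 (cis t) x)) has_derivative
      (\<lambda>h. h *\<^sub>R ((- (?y $ 2)) *\<^sub>R partial_deriv 1 f ?y + (?y $ 1) *\<^sub>R partial_deriv 2 f ?y))) (at t)"
    by (simp only: sum_2 vector_add_component vector_scaleR_component)
      (simp add: axis_def scaleR_add_right)
  then show ?thesis
    unfolding has_vector_derivative_def angular_def
    by (simp only: scaleR_conv_of_real of_real_minus) (simp add: algebra_simps)
qed

lemma continuous_on_circle_average:
  assumes f: "continuous_on UNIV (f :: real^2 \<Rightarrow> real)"
  shows "continuous_on UNIV (\<lambda>x. integral {0..2*pi} (\<lambda>t. f (rotate2 (cis t) x)))"
proof -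
  have "continuous_on (UNIV \<times> cbox 0 (2 * pi)) (\<lambda>(x, t). f (rotate2 (cis t) x))"
    unfolding split_beta
    by (rule continuous_on_compose2[OF f]) (auto intro!: continuous_on_rotate2 continuous_intros)
  from integral_continuous_on_param[OF this] show ?thesis by simp
qed

text \<open>Fubini together with invariance of the integral under each rotation. This takes the
  place of polar coordinates.\<close>

lemma integral_circle_average:
  assumes f: "continuous_on UNIV (f :: real^2 \<Rightarrow> real)" "\<And>x. norm x > M \<Longrightarrow> f x = 0"
  shows "(\<lambda>x. integral {0..2*pi} (\<lambda>t. f (rotate2 (cis t) x))) integrable_on UNIV"
    and "integral UNIV (\<lambda>x. integral {0..2*pi} (\<lambda>t. f (rotate2 (cis t) x))) = 2 * pi * integral UNIV f"
proof -
  have supp: "f (rotate2 (cis t) x) = 0" if "norm x > M" for t x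
    using that by (intro f(2)) (simp add: norm_rotate2)
  then have "integral {0..2*pi} (\<lambda>t. f (rotate2 (cis t) x)) = 0" if "norm x > M" for x
    using that by simp
  then show "(\<lambda>x. integral {0..2*pi} (\<lambda>t. f (rotate2 (cis t) x))) integrable_on UNIV"
    using absolutely_integrable_bounded_support[OF continuous_on_circle_average[OF f(1)]]
      set_lebesgue_integral_eq_integral(1) by blast
  have "continuous_on UNIV (\<lambda>(t, x). f (rotate2 (cis t) x))"
    unfolding split_beta
    by (rule continuous_on_compose2[OF f(1)]) (auto intro!: continuous_on_rotate2 continuous_intros)
  then have "integral UNIV (\<lambda>x. integral {0..2*pi} (\<lambda>t. f (rotate2 (cis t) x)))
      = integral {0..2*pi} (\<lambda>t. integral UNIV (\<lambda>x. f (rotate2 (cis t) x)))"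
    using supp by (intro integral_swap_bounded_support[where M = M]) auto
  also have "\<dots> = integral {0..2*pi} (\<lambda>t. integral UNIV f)"
    by (simp add: integral_rotate2[OF f])
  finally show "integral UNIV (\<lambda>x. integral {0..2*pi} (\<lambda>t. f (rotate2 (cis t) x))) = 2 * pi * integral UNIV f"
    by simp
qed

text \<open>The weight is invariant under rotations, so it can be pulled out of the integral over
  the circle.\<close>

lemma form_circle_average:
  assumes f: "f \<in> test_functions punctured"
  shows "(\<lambda>x. integral {0..2*pi} (\<lambda>t. (cmod (f (rotate2 (cis t) x)))\<^sup>2) / norm x ^ 4) integrable_on UNIV"
    and "integral UNIV (\<lambda>x. integral {0..2*pi} (\<lambda>t. (cmod (f (rotate2 (cis t) x)))\<^sup>2) / norm x ^ 4)
      = 2 * pi * form f f"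
proof -
  define g where "g x = Re (weight x * (f x * cnj (f x)))" for x
  have T: "(\<lambda>x. weight x * (f x * cnj (f x))) \<in> test_functions punctured"
    by (rule punctured_form_integrand[OF f f])
  obtain M where M: "\<And>x. norm x > M \<Longrightarrow> weight x * (f x * cnj (f x)) = 0"
    using test_functions_bounded_support[OF T] by blast
  have g: "continuous_on UNIV g" "\<And>x. norm x > M \<Longrightarrow> g x = 0"
    unfolding g_def using M by (auto simp only: zero_complex.sel intro!: continuous_on_Re punctured_continuous[OF T])
  have "g (rotate2 (cis t) x) = (cmod (f (rotate2 (cis t) x)))\<^sup>2 / norm x ^ 4" for t x
    by (simp add: g_def weight_norm norm_rotate2 complex_mult_cnj cmod_power2)
  then have "integral {0..2*pi} (\<lambda>t. g (rotate2 (cis t) x))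
      = integral {0..2*pi} (\<lambda>t. (cmod (f (rotate2 (cis t) x)))\<^sup>2) / norm x ^ 4" for x
    by simp
  then show "(\<lambda>x. integral {0..2*pi} (\<lambda>t. (cmod (f (rotate2 (cis t) x)))\<^sup>2) / norm x ^ 4) integrable_on UNIV"
    "integral UNIV (\<lambda>x. integral {0..2*pi} (\<lambda>t. (cmod (f (rotate2 (cis t) x)))\<^sup>2) / norm x ^ 4)
      = 2 * pi * form f f"
    using integral_circle_average[OF g] by (simp_all add: form_def g_def)
qed

text \<open>The circle inequality on the orbit of each \<open>x\<close>, divided by
  \<open>|x|^4\<close> and integrated over the plane; the factor \<open>2 pi\<close> from the
  averaging cancels.\<close>

lemma form_angular_operator:
  assumes f: "f \<in> test_functions punctured"
  shows "C_AB \<Psi> * (form f f + form (angular \<Psi> f) (angular \<Psi> f))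
    \<le> form (\<lambda>x. f x + angular \<Psi> (angular \<Psi> f) x) (\<lambda>x. f x + angular \<Psi> (angular \<Psi> f) x)"
proof -
  define g where "g = angular \<Psi> f"
  define h where "h = angular \<Psi> g"
  have g: "g \<in> test_functions punctured" unfolding g_def by (rule punctured_angular[OF f])
  have h: "h \<in> test_functions punctured" unfolding h_def by (rule punctured_angular[OF g])
  have fh: "(\<lambda>x. f x + h x) \<in> test_functions punctured" by (rule punctured_add[OF f h])
  let ?I = "\<lambda>f x. integral {0..2*pi} (\<lambda>t. (cmod (f (rotate2 (cis t) x)))\<^sup>2)"
  have cont: "continuous_on (sphere 0 1) (\<lambda>z. u (rotate2 z x))" if "u \<in> test_functions punctured" for u x
    by (rule continuous_on_compose2[OF punctured_continuous[OF that, of UNIV]])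
      (auto intro!: continuous_on_rotate2 continuous_intros)
  have pw: "C_AB \<Psi> * (?I f x + ?I g x) \<le> ?I (\<lambda>x. f x + h x) x" for x
    using has_vector_derivative_rotate2[OF f] has_vector_derivative_rotate2[OF g]
    by (intro circle_operator_inequality[where V = "\<lambda>z. f (rotate2 z x)" and V' = "\<lambda>z. g (rotate2 z x)"
          and V'' = "\<lambda>z. h (rotate2 z x)"] cont f g h C_AB_nonneg C_AB_le) (auto simp: g_def h_def C_AB_le)
  note I = form_circle_average
  have "C_AB \<Psi> * (2 * pi * form f f + 2 * pi * form g g)
      = integral UNIV (\<lambda>x. C_AB \<Psi> * (?I f x / norm x ^ 4 + ?I g x / norm x ^ 4))"
    using I[OF f] I[OF g] by (simp add: integral_add)
  also have "\<dots> \<le> integral UNIV (\<lambda>x. ?I (\<lambda>x. f x + h x) x / norm x ^ 4)"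
  proof (rule integral_le)
    show "(\<lambda>x. C_AB \<Psi> * (?I f x / norm x ^ 4 + ?I g x / norm x ^ 4)) integrable_on UNIV"
      by (intro integrable_on_mult_right integrable_add I f g)
    show "(\<lambda>x. ?I (\<lambda>x. f x + h x) x / norm x ^ 4) integrable_on UNIV"
      by (rule I(1)[OF fh])
    show "C_AB \<Psi> * (?I f x / norm x ^ 4 + ?I g x / norm x ^ 4) \<le> ?I (\<lambda>x. f x + h x) x / norm x ^ 4" for x
      using divide_right_mono[OF pw[of x], of "norm x ^ 4"] by (simp add: add_divide_distrib[symmetric])
  qed
  also have "\<dots> = 2 * pi * form (\<lambda>x. f x + h x) (\<lambda>x. f x + h x)"
    by (rule I(2)[OF fh])
  finally have "2 * pi * (C_AB \<Psi> * (form f f + form g g)) \<le> 2 * pi * form (\<lambda>x. f x + h x) (\<lambda>x. f x + h x)"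
    by (simp add: algebra_simps)
  then show ?thesis by (simp add: g_def h_def)
qed

section \<open>The inequality for the weighted forms\<close>

text \<open>The expansion of the square from the overview, with \<open>b = B f\<close>,
  \<open>u = B^2 f\<close>, \<open>l = L^2 f\<close> and \<open>p = (1 + L^2) f\<close>.\<close>

lemma form_rellich:
  assumes f: "f \<in> test_functions punctured"
  shows "C_AB \<Psi> * (form (radial f) (radial f) + form (angular \<Psi> f) (angular \<Psi> f))
    \<le> form (\<lambda>x. radial (radial f) x + angular \<Psi> (angular \<Psi> f) x)
        (\<lambda>x. radial (radial f) x + angular \<Psi> (angular \<Psi> f) x)"
proof -
  define b where "b = radial1 f"
  define u where "u = radial1 b"
  define l where "l = angular \<Psi> (angular \<Psi> f)"
  define p where "p = (\<lambda>x. f x + l x)"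
  have b: "b \<in> test_functions punctured" unfolding b_def by (rule punctured_radial1[OF f])
  have u: "u \<in> test_functions punctured" unfolding u_def by (rule punctured_radial1[OF b])
  have Lf: "angular \<Psi> f \<in> test_functions punctured" by (rule punctured_angular[OF f])
  have Lb: "angular \<Psi> b \<in> test_functions punctured" by (rule punctured_angular[OF b])
  have l: "l \<in> test_functions punctured" unfolding l_def by (rule punctured_angular[OF Lf])
  have p: "p \<in> test_functions punctured" unfolding p_def by (rule punctured_add[OF f l])
  have skew0: "form (radial1 g) g = 0" if "g \<in> test_functions punctured" for g
    using form_radial1[OF that that] by (simp add: form_commute[of g])
  have comm: "radial1 l = angular \<Psi> (angular \<Psi> b)"
    unfolding l_def b_def by (simp add: radial1_angular_commute f Lf)
  \<comment> \<open>Moving one \<open>L\<close> to the left gives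
    \<open>- form (L B f) (L f)\<close>. Since \<open>L\<close> and \<open>B\<close> commute, this
    is \<open>form (B g) g\<close> for \<open>g = L f\<close> up to sign, hence
    \<open>0\<close>.\<close>
  have "form b l = - form (angular \<Psi> b) (angular \<Psi> f)"
    unfolding l_def using form_angular[OF b Lf] by simp
  also have "\<dots> = 0"
    using skew0[OF Lf] by (simp add: b_def radial1_angular_commute[OF f])
  finally have bp: "form b p = 0"
    unfolding p_def using skew0[OF f] by (simp add: form_add_right b f l b_def[symmetric])
  have ub: "form u b = 0" unfolding u_def by (rule skew0[OF b])
  \<comment> \<open>Moving one \<open>B\<close> to the right turns \<open>p\<close> into
    \<open>(1 + L^2) b\<close>; skewness of \<open>L\<close> then makes the cross term the squared
    norm of \<open>L b\<close> minus that of \<open>b\<close>.\<close>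
  have "form u p = - form b (radial1 p)"
    unfolding u_def by (rule form_radial1[OF b p])
  also have "radial1 p = (\<lambda>x. b x + angular \<Psi> (angular \<Psi> b) x)"
    unfolding p_def radial1_add[OF f l] comm b_def ..
  also have "form b \<dots> = form b b - form (angular \<Psi> b) (angular \<Psi> b)"
    using form_angular[OF b Lb, of \<Psi>] by (simp add: form_add_right b punctured_angular Lb)
  finally have up: "form u p = form (angular \<Psi> b) (angular \<Psi> b) - form b b" by simp
  have bb: "(\<lambda>x. b x + p x) \<in> test_functions punctured" by (rule punctured_add[OF b p])
  have bbb: "(\<lambda>x. b x + (b x + p x)) \<in> test_functions punctured" by (rule punctured_add[OF b bb])
  have rr: "radial b = (\<lambda>x. radial (radial f) x - radial f x)"
    unfolding b_def radial1_def[abs_def] by (rule radial_diff[OF punctured_radial[OF f] f])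
  \<comment> \<open>This is \<open>R^2 = B^2 + 2 B + 1\<close>, with \<open>2 B\<close> as a
    repeated summand so that additivity of the form suffices for the expansion.\<close>
  have Z: "(\<lambda>x. radial (radial f) x + l x) = (\<lambda>x. u x + (b x + (b x + p x)))"
    unfolding u_def radial1_def[of b] rr p_def by (auto simp: b_def radial1_def)
  \<comment> \<open>The coefficient of \<open>form b b\<close> is \<open>4 - 2\<close>:
    \<open>4\<close> from the square of \<open>2 b\<close> and \<open>-2\<close> from twice the
    cross term \<open>form u p\<close>.\<close>
  have "form (\<lambda>x. u x + (b x + (b x + p x))) (\<lambda>x. u x + (b x + (b x + p x)))
      = form u u + 2 * form b b + form p p + 2 * form (angular \<Psi> b) (angular \<Psi> b)"
    using form_commute[of b u] form_commute[of p u] form_commute[of p b]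
    by (simp only: form_add_left form_add_right u b p bb bbb punctured_add ub up bp)
  then have ZZ: "2 * form b b + form p p
      \<le> form (\<lambda>x. radial (radial f) x + l x) (\<lambda>x. radial (radial f) x + l x)"
    using form_nonneg[of u] form_nonneg[of "angular \<Psi> b"] unfolding Z by simp
  have R: "radial f = (\<lambda>x. b x + f x)" by (auto simp: b_def radial1_def)
  have fb: "form b f = 0" unfolding b_def by (rule skew0[OF f])
  then have "form (radial f) (radial f) = form b b + form f f"
    unfolding R using form_commute[of f b] by (simp add: form_add_left form_add_right b f punctured_add)
  then have "C_AB \<Psi> * (form (radial f) (radial f) + form (angular \<Psi> f) (angular \<Psi> f))
      = C_AB \<Psi> * form b b + C_AB \<Psi> * (form f f + form (angular \<Psi> f) (angular \<Psi> f))"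
    by (simp add: algebra_simps)
  also have "\<dots> \<le> 2 * form b b + form p p"
  proof (rule add_mono)
    show "C_AB \<Psi> * form b b \<le> 2 * form b b"
      using C_AB_le_1[of \<Psi>] form_nonneg[of b] by (intro mult_right_mono) auto
    show "C_AB \<Psi> * (form f f + form (angular \<Psi> f) (angular \<Psi> f)) \<le> form p p"
      using form_angular_operator[OF f] by (simp add: p_def l_def)
  qed
  finally show ?thesis using ZZ by (simp add: l_def)
qed

section \<open>Translation to the magnetic gradient and Laplacian\<close>

lemma aharonov_bohm_nth:
  "aharonov_bohm \<Psi> x $ 1 = - \<Psi> * x $ 2 / (norm x)\<^sup>2" "aharonov_bohm \<Psi> x $ 2 = \<Psi> * x $ 1 / (norm x)\<^sup>2"
  by (simp_all add: aharonov_bohm_def power2_norm_vec2)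

lemma smooth_on_aharonov_bohm: "smooth_on (\<lambda>x. of_real (aharonov_bohm \<Psi> x $ j)) punctured"
proof -
  have "smooth_on (\<lambda>x. of_real c * of_real (x $ k) * inverse (radius2 x)) punctured" for c k
    by (intro smooth_on_mult smooth_on_inverse smooth_on_const smooth_on_coordinate smooth_on_radius2
        open_punctured) (simp add: radius2_eq_0_iff)
  from this[of "- \<Psi>" 2] this[of \<Psi> 1] show ?thesis
    using exhaust_2[of j]
    by (auto simp: aharonov_bohm_nth radius2_norm divide_inverse power2_eq_square)
qed

context
  fixes \<Psi> :: real
begin

private abbreviation M where "M \<equiv> magnetic_partial (aharonov_bohm \<Psi>)"

lemma punctured_magnetic_partial:
  assumes f: "f \<in> test_functions punctured" shows "M j f \<in> test_functions punctured"
  unfolding magnetic_partial_def[abs_def]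
  using smooth_on_mult[OF open_punctured smooth_on_const smooth_on_aharonov_bohm, of \<i>]
  by (intro punctured_diff punctured_partial_deriv f punctured_mult)

lemma magnetic_partial_coordinate:
  assumes "f \<in> test_functions punctured"
  shows "M j (\<lambda>x. of_real (x $ k) * f x) x = (if j = k then f x else 0) + of_real (x $ k) * M j f x"
  unfolding magnetic_partial_def partial_deriv_coordinate_mult[OF punctured_differentiable[OF assms]]
  by (simp add: algebra_simps)

lemma magnetic_partial_add:
  assumes "f \<in> test_functions punctured" "g \<in> test_functions punctured"
  shows "M j (\<lambda>x. f x + g x) x = M j f x + M j g x"
  using assms by (simp add: magnetic_partial_def partial_deriv_add punctured_differentiable algebra_simps)

lemma magnetic_partial_diff:
  assumes "f \<in> test_functions punctured" "g \<in> test_functions punctured"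
  shows "M j (\<lambda>x. f x - g x) x = M j f x - M j g x"
  using assms by (simp add: magnetic_partial_def partial_deriv_minus punctured_differentiable algebra_simps)

text \<open>The Aharonov-Bohm potential is orthogonal to \<open>x\<close>, so magnetic and ordinary
  derivatives agree in the radial direction.\<close>

lemma radial_magnetic:
  "radial f = (\<lambda>x. of_real (x $ 1) * M 1 f x + of_real (x $ 2) * M 2 f x)"
  by (auto simp: radial_def magnetic_partial_def aharonov_bohm_nth algebra_simps)

text \<open>Away from the origin \<open>x\<^sub>1 A\<^sub>2 - x\<^sub>2 A\<^sub>1 = \<Psi>\<close>,
  which produces the zeroth-order term of \<open>angular \<Psi>\<close>. At the origin both sides
  vanish.\<close>

lemma angular_magnetic:
  assumes f: "f \<in> test_functions punctured"
  shows "angular \<Psi> f = (\<lambda>x. of_real (x $ 1) * M 2 f x - of_real (x $ 2) * M 1 f x)"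
proof
  fix x
  show "angular \<Psi> f x = of_real (x $ 1) * M 2 f x - of_real (x $ 2) * M 1 f x"
  proof (cases "x = 0")
    case True
    then show ?thesis using test_functions_punctured_zero[OF f] by (simp add: angular_def)
  next
    case False
    define A where "A = aharonov_bohm \<Psi> x"
    have "x $ 1 * A $ 2 - x $ 2 * A $ 1 = \<Psi> * ((x $ 1)\<^sup>2 + (x $ 2)\<^sup>2) / (norm x)\<^sup>2"
      by (simp add: A_def aharonov_bohm_nth power2_eq_square algebra_simps add_divide_distrib)
    also have "\<dots> = \<Psi>" using False unfolding power2_norm_vec2[symmetric] by simp
    finally have psi: "of_real \<Psi> = complex_of_real (x $ 1) * A $ 2 - x $ 2 * A $ 1"
      by (metis of_real_diff of_real_mult)
    show ?thesis
      unfolding angular_def magnetic_partial_def A_def[symmetric] psi by (simp add: algebra_simps)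
  qed
qed

text \<open>In \<open>R^2 + L^2\<close>, expanded through the magnetic partial derivatives, the
  first-order terms cancel, and so do the mixed terms \<open>x\<^sub>1 x\<^sub>2 (M\<^sub>1
  M\<^sub>2 + M\<^sub>2 M\<^sub>1)\<close>. The terms left over are \<open>|x|^2\<close> times the
  magnetic Laplacian.\<close>

lemma radial_angular_laplacian:
  assumes f: "f \<in> test_functions punctured"
  shows "radial (radial f) x + angular \<Psi> (angular \<Psi> f) x
    = radius2 x * magnetic_laplacian (aharonov_bohm \<Psi>) f x"
proof -
  note Mf = punctured_magnetic_partial[OF f]
  have 1: "M j (radial f) x = (if j = 1 then M 1 f x else 0) + of_real (x $ 1) * M j (M 1 f) x
      + ((if j = 2 then M 2 f x else 0) + of_real (x $ 2) * M j (M 2 f) x)" for j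
    unfolding radial_magnetic[of f]
    by (simp only: magnetic_partial_add magnetic_partial_coordinate punctured_coordinate Mf)
  have 2: "M j (angular \<Psi> f) x = (if j = 1 then M 2 f x else 0) + of_real (x $ 1) * M j (M 2 f) x
      - ((if j = 2 then M 1 f x else 0) + of_real (x $ 2) * M j (M 1 f) x)" for j
    unfolding angular_magnetic[OF f]
    by (simp only: magnetic_partial_diff magnetic_partial_coordinate punctured_coordinate Mf)
  have "magnetic_laplacian (aharonov_bohm \<Psi>) f x = M 1 (M 1 f) x + M 2 (M 2 f) x"
    by (simp add: magnetic_laplacian_def magnetic_divergence_def magnetic_gradient_def sum_2)
  then show ?thesis
    unfolding radial_magnetic[of "radial f"] angular_magnetic[OF punctured_angular[OF f]] 1 2
    by (simp add: radius2_def algebra_simps)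
qed

text \<open>Passes from the gauge integral in \<open>form\<close> to the Lebesgue integral of the
  theorem; the two agree for Lebesgue integrable functions.\<close>

lemma form_integral_lborel:
  assumes "u \<in> test_functions punctured"
  shows "integrable lborel (\<lambda>x. (cmod (u x))\<^sup>2 / norm x ^ 4)"
    and "(\<integral>x. (cmod (u x))\<^sup>2 / norm x ^ 4 \<partial>lborel) = form u u"
proof -
  have T: "(\<lambda>x. weight x * (u x * cnj (u x))) \<in> test_functions punctured"
    by (rule punctured_form_integrand[OF assms assms])
  have "Re (weight x * (u x * cnj (u x))) = (cmod (u x))\<^sup>2 / norm x ^ 4" for x
    by (simp add: weight_norm complex_mult_cnj cmod_power2)
  moreover have i: "integrable lborel (\<lambda>x. Re (weight x * (u x * cnj (u x))))"
    by (intro integrable_Re punctured_integrable(1)[OF T])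
  ultimately show "integrable lborel (\<lambda>x. (cmod (u x))\<^sup>2 / norm x ^ 4)"
    "(\<integral>x. (cmod (u x))\<^sup>2 / norm x ^ 4 \<partial>lborel) = form u u"
    using integral_lborel[OF i] by (simp_all add: form_def)
qed

lemma magnetic_laplacian_form:
  assumes f: "f \<in> test_functions punctured"
  shows "(\<integral>x. (cmod (magnetic_laplacian (aharonov_bohm \<Psi>) f x))\<^sup>2 \<partial>lborel)
    = form (\<lambda>x. radial (radial f) x + angular \<Psi> (angular \<Psi> f) x)
        (\<lambda>x. radial (radial f) x + angular \<Psi> (angular \<Psi> f) x)"
proof -
  have "(\<lambda>x. radial (radial f) x + angular \<Psi> (angular \<Psi> f) x) \<in> test_functions punctured"
    by (intro punctured_add punctured_radial punctured_angular f)
  note form_integral_lborel(2)[OF this, symmetric]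
  moreover have "(cmod (magnetic_laplacian (aharonov_bohm \<Psi>) f x))\<^sup>2
      = (cmod (radial (radial f) x + angular \<Psi> (angular \<Psi> f) x))\<^sup>2 / norm x ^ 4" for x
  proof (cases "x = 0")
    \<comment> \<open>At the origin the right-hand side is \<open>0\<close> through division by
      zero, and the Laplacian, built from test functions, vanishes there as well.\<close>
    case True
    have "magnetic_laplacian (aharonov_bohm \<Psi>) f x = M 1 (M 1 f) x + M 2 (M 2 f) x"
      by (simp add: magnetic_laplacian_def magnetic_divergence_def magnetic_gradient_def sum_2)
    also have "\<dots> = 0"
      using True test_functions_punctured_zero[OF punctured_magnetic_partial[OF punctured_magnetic_partial[OF f]]]
      by simp
    finally show ?thesis using True by simp
  next
    case False
    then show ?thesis
      unfolding radial_angular_laplacian[OF f] radius2_norm norm_mult norm_of_real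
      by (simp add: power_mult_distrib flip: power_mult)
  qed
  ultimately show ?thesis by simp
qed

text \<open>Pointwise this is the Lagrange identity \<open>|x\<^sub>1 a + x\<^sub>2 b|^2 +
  |x\<^sub>1 b - x\<^sub>2 a|^2 = |x|^2 (|a|^2 + |b|^2)\<close> for real coordinates and complex
  \<open>a\<close>, \<open>b\<close>, the two magnetic partial derivatives.\<close>

lemma magnetic_gradient_form:
  assumes f: "f \<in> test_functions punctured"
  shows "(\<integral>x. (norm (magnetic_gradient (aharonov_bohm \<Psi>) f x))\<^sup>2 / (norm x)\<^sup>2 \<partial>lborel)
    = form (radial f) (radial f) + form (angular \<Psi> f) (angular \<Psi> f)"
proof -
  have "(norm (magnetic_gradient (aharonov_bohm \<Psi>) f x))\<^sup>2 / (norm x)\<^sup>2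
      = (cmod (radial f x))\<^sup>2 / norm x ^ 4 + (cmod (angular \<Psi> f x))\<^sup>2 / norm x ^ 4" for x
  proof (cases "x = 0")
    case False
    have "(cmod (radial f x))\<^sup>2 + (cmod (angular \<Psi> f x))\<^sup>2
        = ((x $ 1)\<^sup>2 + (x $ 2)\<^sup>2) * ((cmod (M 1 f x))\<^sup>2 + (cmod (M 2 f x))\<^sup>2)"
      unfolding radial_magnetic[of f] angular_magnetic[OF f] cmod_power2
      by (simp add: power2_eq_square algebra_simps)
    also have "\<dots> = (norm x)\<^sup>2 * (norm (magnetic_gradient (aharonov_bohm \<Psi>) f x))\<^sup>2"
      unfolding power2_norm_vec2 power2_norm_eq_inner[of "magnetic_gradient _ f x"] inner_vec_def sum_2
      by (simp add: magnetic_gradient_def power2_norm_eq_inner)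
    finally show ?thesis
      using False by (simp add: add_divide_distrib[symmetric] power4_eq_xxxx power2_eq_square)
  qed simp
  then show ?thesis
    using form_integral_lborel[OF punctured_radial[OF f]] form_integral_lborel[OF punctured_angular[OF f, of \<Psi>]]
    by simp
qed

end

theorem corollary1p2:
  fixes \<Psi> :: real
  shows "(C_AB \<Psi> \<in> range (AB_quotient \<Psi>) \<and> (\<forall>m. C_AB \<Psi> \<le> AB_quotient \<Psi> m)) \<and>
    (\<forall>\<psi> \<in> test_functions (- {0 :: real^2}).
      (\<integral>x. (cmod (magnetic_laplacian (aharonov_bohm \<Psi>) \<psi> x))\<^sup>2 \<partial>lborel)
        \<ge> C_AB \<Psi> * (\<integral>x. (norm (magnetic_gradient (aharonov_bohm \<Psi>) \<psi> x))\<^sup>2 / (norm x)\<^sup>2 \<partial>lborel))"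
  by (simp add: C_AB_attained C_AB_le magnetic_laplacian_form magnetic_gradient_form form_rellich)

end
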